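(* Let $\gamma\in(0,1/3)$ and $\delta\in(0,1)$ satisfy $$\frac{4(\gamma^2+\delta^2)}{(1-3\gamma)^2}\left(1-\frac{\delta}{\sqrt{2(k+1)}}\right)^{-1}<\gamma .$$ Assume that $(\mathbf{x}_0,\mathbf{y}_0,\mathbf{s}_0,\kappa_0,\tau_0)\in\mathcal{N}_2(\gamma)$, and that in Algorithm 1 (described in the context) the scaling matrix $\mathbf{D}$ used in each iteration belongs to $\mathcal{G}$. Then the iterate $(\mathbf{x},\mathbf{y},\mathbf{s},\kappa,\tau)$ obtained after $j$ iterations of Algorithm 1 satisfies $$(\mathbf{x},\mathbf{y},\mathbf{s},\kappa,\tau)\in\mathcal{N}_2(\gamma),$$ $$\|\mathbf{r}_p(\mathbf{x},\mathbf{y},\mathbf{s},\kappa,\tau)\|=\left(1-\tfrac{\delta}{\sqrt{2(k+1)}}\right)^j\|\mathbf{r}_p(\mathbf{x}_0,\mathbf{y}_0,\mathbf{s}_0,\kappa_0,\tau_0)\|,$$ $$\|\mathbf{r}_d(\mathbf{x},\mathbf{y},\mathbf{s},\kappa,\tau)\|=\left(1-\tfrac{\delta}{\sqrt{2(k+1)}}\right)^j\|\mathbf{r}_d(\mathbf{x}_0,\mathbf{y}_0,\mathbf{s}_0,\kappa_0,\tau_0)\|,$$ $$\mu(\mathbf{x},\mathbf{s},\kappa,\tau)=\left(1-\tfrac{\delta}{\sqrt{2(k+1)}}\right)^j\mu(\mathbf{x}_0,\mathbf{s}_0,\kappa_0,\tau_0).$$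
   Context: Norms are Euclidean; $(\mathbf{u},\mathbf{v})$ denotes concatenation of column vectors. Cones: $\mathcal{K}=\mathcal{K}^1\times\cdots\times\mathcal{K}^k\subset\mathbb{R}^n$, where $\mathcal{K}^i\subset\mathbb{R}^{n_i}$ is the second-order cone $\{\mathbf{v}\in\mathbb{R}^{n_i}:\mathbf{v}_1\ge\|\mathbf{v}_{2:n_i}\|\}$ (for $n_i=1$ it is $[0,\infty)$), $n=\sum_i n_i$. For $\mathbf{v}\in\mathbb{R}^n$, $\mathbf{v}^{(i)}$ is the block of $\mathbf{v}$ in the position of $\mathcal{K}^i$. Data: $\mathbf{A}\in\mathbb{R}^{p\times n}$ with $\mathrm{rank}(\mathbf{A})=p\le n$, $\mathbf{b}\in\mathbb{R}^p$, $\mathbf{c}\in\mathbb{R}^n$. Jordan algebra: $\mathbf{e}=(\mathbf{e}^{(1)},\dots,\mathbf{e}^{(k)})$ with $\mathbf{e}^{(i)}=(1,0,\dots,0)^T$. $\mathrm{mat}(\mathbf{v})$ is block diagonal with blocks $\begin{pmatrix}\mathbf{v}^{(i)}_1&(\mathbf{v}^{(i)}_{2:n_i})^T\\ \mathbf{v}^{(i)}_{2:n_i}&\mathbf{v}^{(i)}_1\mathbf{I}\end{pmatrix}$. For $\mathbf{x}\in\mathrm{int}(\mathcal{K})$, $\mathbf{T}_x$ is block diagonal with blocks $\mathbf{T}_{x^{(i)}}$, where $\mathbf{T}_u=\begin{pmatrix}\mathbf{u}_1&\mathbf{u}_{2:}^T\\ \mathbf{u}_{2:}&\beta_u\mathbf{I}+\frac{\mathbf{u}_{2:}\mathbf{u}_{2:}^T}{\beta_u+\mathbf{u}_1}\end{pmatrix}$,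 $\beta_u=\sqrt{\mathbf{u}_1^2-\|\mathbf{u}_{2:}\|^2}$ (for a one-dimensional block, $\mathbf{T}_u=\mathbf{u}_1$), and $\mathbf{u}_{2:}$ denotes $\mathbf{u}$ without its first entry. Scaling matrices: $\mathcal{G}$ is the set of block-diagonal matrices $\mathrm{blkdiag}(\theta^1\mathbf{G}^1,\dots,\theta^k\mathbf{G}^k)$ with $\theta^i>0$, $\mathbf{G}^i\in\mathbb{R}^{n_i\times n_i}$, $(\mathbf{G}^i)^T\mathbf{Q}^i\mathbf{G}^i=\mathbf{Q}^i$, where $\mathbf{Q}^i=\mathrm{diag}(1,-1,\dots,-1)$. Central path quantities: $\mu(\mathbf{x},\mathbf{s},\kappa,\tau)=(\mathbf{x}^T\mathbf{s}+\kappa\tau)/(k+1)$; $\mathbf{w}_{xs\kappa\tau}=(\mathbf{T}_x\mathbf{s},\kappa\tau)\in\mathbb{R}^{n+1}$; $d_2(\mathbf{x},\mathbf{s},\kappa,\tau)=\sqrt2\,\|\mathbf{w}_{xs\kappa\tau}-\mu(\mathbf{x},\mathbf{s},\kappa,\tau)\,(\mathbf{e},1)\|$; $\mathcal{N}_2(\gamma)$ is the set of $(\mathbf{x},\mathbf{y},\mathbf{s},\kappa,\tau)$ with $\mathbf{x},\mathbf{s}\in\mathrm{int}(\mathcal{K})$, $\mathbf{y}\in\mathbb{R}^p$, $\kappa,\tau>0$ and $d_2(\mathbf{x},\mathbf{s},\kappa,\tau)\le\gamma\mu(\mathbf{x},\mathbf{s},\kappa,\tau)$. Residuals: $\mathbf{r}_p(\mathbf{x},\mathbf{y},\mathbf{s},\kappa,\tau)=\mathbf{A}\mathbf{x}-\tau\mathbf{b}$,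 $\mathbf{r}_d(\mathbf{x},\mathbf{y},\mathbf{s},\kappa,\tau)=\mathbf{A}^T\mathbf{y}+\mathbf{s}-\tau\mathbf{c}$. Algorithm 1: given $\gamma,\delta\in(0,1)$, a threshold $\epsilon\in(0,1)$ and the initial point $(\mathbf{x}_0,\mathbf{y}_0,\mathbf{s}_0,\kappa_0,\tau_0)\in\mathcal{N}_2(\gamma)$, set $\nu=1-\delta/\sqrt{2(k+1)}$ and start at the initial point. While the stopping criterion ($\|\mathbf{r}_p\|$, $\|\mathbf{r}_d\|$ and $\mu$ at the current iterate are each at most $\epsilon$ times their values at the initial point) does not hold, do one iteration: put $\mu=\mu(\mathbf{x},\mathbf{s},\kappa,\tau)$, choose a scaling matrix $\mathbf{D}$, put $\bar{\mathbf{x}}=\mathbf{D}^{-T}\mathbf{x}$, $\bar{\mathbf{s}}=\mathbf{D}\mathbf{s}$, $\bar{\mathbf{X}}=\mathrm{mat}(\bar{\mathbf{x}})$, $\bar{\mathbf{S}}=\mathrm{mat}(\bar{\mathbf{s}})$, compute $(\Delta\mathbf{x},\Delta\mathbf{y},\Delta\mathbf{s},\Delta\kappa,\Delta\tau)$ solving $$\begin{aligned}&\mathbf{A}\Delta\mathbf{x}-\mathbf{b}\Delta\tau=-(1-\nu)(\mathbf{A}\mathbf{x}-\mathbf{b}\tau),\\ &-\mathbf{A}^T\Delta\mathbf{y}+\mathbf{c}\Delta\tau-\Delta\mathbf{s}=-(1-\nu)(-\mathbf{A}^T\mathbf{y}+\mathbf{c}\tau-\mathbf{s}),\\ &\mathbf{b}^T\Delta\mathbf{y}-\mathbf{c}^T\Delta\mathbf{x}-\Delta\kappa=-(1-\nu)(\mathbf{b}^T\mathbf{y}-\mathbf{c}^T\mathbf{x}-\kappa),\\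 &\bar{\mathbf{X}}\mathbf{D}\Delta\mathbf{s}+\bar{\mathbf{S}}\mathbf{D}^{-T}\Delta\mathbf{x}=\nu\mu\mathbf{e}-\bar{\mathbf{X}}\bar{\mathbf{S}}\mathbf{e},\\ &\kappa\Delta\tau+\tau\Delta\kappa=\nu\mu-\kappa\tau,\end{aligned}$$ and replace the iterate by $(\mathbf{x},\mathbf{y},\mathbf{s},\kappa,\tau)+(\Delta\mathbf{x},\Delta\mathbf{y},\Delta\mathbf{s},\Delta\kappa,\Delta\tau)$. *)

theory Defs
  imports "HOL-Analysis.Analysis"
begin

text \<open>
  The space $R^n$ is \<^typ>\<open>real^'n\<close>. Its decomposition into $k$ blocks is given by a map
  \<open>blk\<close> sending a coordinate to the block containing it, and a map \<open>lead\<close> selecting the first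
  coordinate of each block. The requirement \<open>blk (lead i) = i\<close> is imposed where it is needed; it
  says that \<open>lead i\<close> lies in block \<open>i\<close>, so in particular every block is nonempty. Blocks may be
  arbitrary subsets of the index type, which carries no order. A block with $n_i = 1$ has an
  empty tail.
\<close>

definition tail_ix :: "('n::finite \<Rightarrow> 'k::finite) \<Rightarrow> ('k \<Rightarrow> 'n) \<Rightarrow> 'k \<Rightarrow> 'n set" where
  "tail_ix blk lead i = {j. blk j = i \<and> j \<noteq> lead i}"

definition tail_norm ::
  "('n::finite \<Rightarrow> 'k::finite) \<Rightarrow> ('k \<Rightarrow> 'n) \<Rightarrow> real^'n \<Rightarrow> 'k \<Rightarrow> real" where
  "tail_norm blk lead v i = L2_set (\<lambda>j. v $ j) (tail_ix blk lead i)"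

definition soc_product :: "('n::finite \<Rightarrow> 'k::finite) \<Rightarrow> ('k \<Rightarrow> 'n) \<Rightarrow> (real^'n) set" where
  "soc_product blk lead = {v. \<forall>i. v $ lead i \<ge> tail_norm blk lead v i}"

definition jordan_unit :: "('n::finite \<Rightarrow> 'k::finite) \<Rightarrow> ('k \<Rightarrow> 'n) \<Rightarrow> real^'n" where
  "jordan_unit blk lead = (\<chi> j. if j = lead (blk j) then 1 else 0)"

text \<open>\<open>B i a b\<close> is the entry of the \<open>i\<close>-th diagonal block in row \<open>a\<close> and column \<open>b\<close>; it is only
  used for \<open>a\<close> and \<open>b\<close> in block \<open>i\<close>.\<close>

definition blkdiag ::
  "('n::finite \<Rightarrow> 'k::finite) \<Rightarrow> ('k \<Rightarrow> 'n \<Rightarrow> 'n \<Rightarrow> real) \<Rightarrow> real^'n^'n" where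
  "blkdiag blk B = (\<chi> a b. if blk a = blk b then B (blk a) a b else 0)"

definition jordan_mat ::
  "('n::finite \<Rightarrow> 'k::finite) \<Rightarrow> ('k \<Rightarrow> 'n) \<Rightarrow> real^'n \<Rightarrow> real^'n^'n" where
  "jordan_mat blk lead v = blkdiag blk (\<lambda>i a b.
     if a = lead i then v $ b
     else if b = lead i then v $ a
     else if a = b then v $ lead i
     else 0)"

definition soc_beta ::
  "('n::finite \<Rightarrow> 'k::finite) \<Rightarrow> ('k \<Rightarrow> 'n) \<Rightarrow> real^'n \<Rightarrow> 'k \<Rightarrow> real" where
  "soc_beta blk lead u i = sqrt ((u $ lead i)\<^sup>2 - (tail_norm blk lead u i)\<^sup>2)"

definition T_mat ::
  "('n::finite \<Rightarrow> 'k::finite) \<Rightarrow> ('k \<Rightarrow> 'n) \<Rightarrow> real^'n \<Rightarrow> real^'n^'n" where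
  "T_mat blk lead u = blkdiag blk (\<lambda>i a b.
     if a = lead i then u $ b
     else if b = lead i then u $ a
     else (if a = b then soc_beta blk lead u i else 0)
            + u $ a * u $ b / (soc_beta blk lead u i + u $ lead i))"

definition Q_entry :: "('k::finite \<Rightarrow> 'n::finite) \<Rightarrow> 'k \<Rightarrow> 'n \<Rightarrow> 'n \<Rightarrow> real" where
  "Q_entry lead i a b = (if a = b then if a = lead i then 1 else -1 else 0)"

text \<open>The double sum is entry \<open>(a, b)\<close> of $(G^i)^T Q^i G^i$.\<close>

definition scaling_matrices ::
  "('n::finite \<Rightarrow> 'k::finite) \<Rightarrow> ('k \<Rightarrow> 'n) \<Rightarrow> (real^'n^'n) set" where
  "scaling_matrices blk lead =
     {blkdiag blk (\<lambda>i a b. \<theta> i * G i a b) | \<theta> G.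
        \<forall>i. \<theta> i > 0 \<and>
          (\<forall>a b. blk a = i \<and> blk b = i \<longrightarrow>
             (\<Sum>r | blk r = i. \<Sum>q | blk q = i. G i r a * Q_entry lead i r q * G i q b)
               = Q_entry lead i a b)}"

text \<open>Here \<open>k\<close> is the number of blocks.\<close>

definition mu :: "nat \<Rightarrow> real^'n::finite \<Rightarrow> real^'n \<Rightarrow> real \<Rightarrow> real \<Rightarrow> real" where
  "mu k x s \<kappa> \<tau> = (x \<bullet> s + \<kappa> * \<tau>) / (real k + 1)"

text \<open>Concatenated vectors in $R^{n+1}$ are pairs; the norm on the product type is the Euclidean
  norm of the concatenation.\<close>

definition w_vec ::
  "('n::finite \<Rightarrow> 'k::finite) \<Rightarrow> ('k \<Rightarrow> 'n) \<Rightarrow> real^'n \<Rightarrow> real^'n \<Rightarrow> real \<Rightarrow> real \<Rightarrow> (real^'n) \<times> real"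
  where
  "w_vec blk lead x s \<kappa> \<tau> = (T_mat blk lead x *v s, \<kappa> * \<tau>)"

definition d2 ::
  "('n::finite \<Rightarrow> 'k::finite) \<Rightarrow> ('k \<Rightarrow> 'n) \<Rightarrow> real^'n \<Rightarrow> real^'n \<Rightarrow> real \<Rightarrow> real \<Rightarrow> real" where
  "d2 blk lead x s \<kappa> \<tau> =
     sqrt 2 * norm (w_vec blk lead x s \<kappa> \<tau> - mu CARD('k) x s \<kappa> \<tau> *\<^sub>R (jordan_unit blk lead, 1))"

type_synonym ('n, 'p) point = "(real^'n) \<times> (real^'p) \<times> (real^'n) \<times> real \<times> real"

definition N2 ::
  "('n::finite \<Rightarrow> 'k::finite) \<Rightarrow> ('k \<Rightarrow> 'n) \<Rightarrow> real \<Rightarrow> ('n, 'p::finite) point set" where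
  "N2 blk lead \<gamma> =
     {(x, y, s, \<kappa>, \<tau>).
        x \<in> interior (soc_product blk lead) \<and> s \<in> interior (soc_product blk lead) \<and>
        \<kappa> > 0 \<and> \<tau> > 0 \<and> d2 blk lead x s \<kappa> \<tau> \<le> \<gamma> * mu CARD('k) x s \<kappa> \<tau>}"

fun r_p :: "real^'n::finite^'p::finite \<Rightarrow> real^'p \<Rightarrow> ('n, 'p) point \<Rightarrow> real^'p" where
  "r_p A b (x, y, s, \<kappa>, \<tau>) = A *v x - \<tau> *\<^sub>R b"

fun r_d :: "real^'n::finite^'p::finite \<Rightarrow> real^'n \<Rightarrow> ('n, 'p) point \<Rightarrow> real^'n" where
  "r_d A c (x, y, s, \<kappa>, \<tau>) = transpose A *v y + s - \<tau> *\<^sub>R c"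

fun stopping_criterion ::
  "nat \<Rightarrow> real^'n::finite^'p::finite \<Rightarrow> real^'p \<Rightarrow> real^'n \<Rightarrow> real
     \<Rightarrow> ('n, 'p) point \<Rightarrow> ('n, 'p) point \<Rightarrow> bool" where
  "stopping_criterion k A b c \<epsilon> (x0, y0, s0, \<kappa>0, \<tau>0) (x, y, s, \<kappa>, \<tau>) \<longleftrightarrow>
     norm (r_p A b (x, y, s, \<kappa>, \<tau>)) \<le> \<epsilon> * norm (r_p A b (x0, y0, s0, \<kappa>0, \<tau>0)) \<and>
     norm (r_d A c (x, y, s, \<kappa>, \<tau>)) \<le> \<epsilon> * norm (r_d A c (x0, y0, s0, \<kappa>0, \<tau>0)) \<and>
     mu k x s \<kappa> \<tau> \<le> \<epsilon> * mu k x0 s0 \<kappa>0 \<tau>0"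

fun search_direction ::
  "('n::finite \<Rightarrow> 'k::finite) \<Rightarrow> ('k \<Rightarrow> 'n) \<Rightarrow> real^'n^'p::finite \<Rightarrow> real^'p \<Rightarrow> real^'n
     \<Rightarrow> real \<Rightarrow> real^'n^'n \<Rightarrow> ('n, 'p) point \<Rightarrow> ('n, 'p) point \<Rightarrow> bool" where
  "search_direction blk lead A b c \<nu> D (x, y, s, \<kappa>, \<tau>) (dx, dy, ds, d\<kappa>, d\<tau>) \<longleftrightarrow>
     (let e = jordan_unit blk lead;
          m = mu CARD('k) x s \<kappa> \<tau>;
          D_invT = transpose (matrix_inv D);
          X = jordan_mat blk lead (D_invT *v x);
          S = jordan_mat blk lead (D *v s)
      in A *v dx - d\<tau> *\<^sub>R b = - (1 - \<nu>) *\<^sub>R (A *v x - \<tau> *\<^sub>R b) \<and>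
         - (transpose A *v dy) + d\<tau> *\<^sub>R c - ds
           = - (1 - \<nu>) *\<^sub>R (- (transpose A *v y) + \<tau> *\<^sub>R c - s) \<and>
         b \<bullet> dy - c \<bullet> dx - d\<kappa> = - (1 - \<nu>) * (b \<bullet> y - c \<bullet> x - \<kappa>) \<and>
         X *v (D *v ds) + S *v (D_invT *v dx) = (\<nu> * m) *\<^sub>R e - X *v (S *v e) \<and>
         \<kappa> * d\<tau> + \<tau> * d\<kappa> = \<nu> * m - \<kappa> * \<tau>)"

definition nu :: "nat \<Rightarrow> real \<Rightarrow> real" where
  "nu k \<delta> = 1 - \<delta> / sqrt (2 * (real k + 1))"

text \<open>\<open>iterate_after \<dots> j z\<close> states that some run of the algorithm performs at least \<open>j\<close> iterations
  and is at \<open>z\<close> after the \<open>j\<close>-th one. The scaling matrix of each iteration is an arbitrary element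
  of \<open>\<D>\<close>, and may change from one iteration to the next.\<close>

inductive iterate_after ::
  "('n::finite \<Rightarrow> 'k::finite) \<Rightarrow> ('k \<Rightarrow> 'n) \<Rightarrow> real^'n^'p::finite \<Rightarrow> real^'p \<Rightarrow> real^'n
     \<Rightarrow> real \<Rightarrow> real \<Rightarrow> (real^'n^'n) set \<Rightarrow> ('n, 'p) point \<Rightarrow> nat \<Rightarrow> ('n, 'p) point \<Rightarrow> bool"
  for blk lead A b c \<delta> \<epsilon> \<D> z0 where
  start: "iterate_after blk lead A b c \<delta> \<epsilon> \<D> z0 0 z0"
| step: "\<lbrakk>iterate_after blk lead A b c \<delta> \<epsilon> \<D> z0 j z;
          \<not> stopping_criterion CARD('k) A b c \<epsilon> z0 z;
          D \<in> \<D>;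
          search_direction blk lead A b c (nu CARD('k) \<delta>) D z dz\<rbrakk>
         \<Longrightarrow> iterate_after blk lead A b c \<delta> \<epsilon> \<D> z0 (Suc j) (z + dz)"

end

theory Submission
  imports Defs
begin

text \<open>
  The search direction solves a Newton equation for \<open>x \<circ> s = \<nu>\<mu>e\<close> that is written in coordinates changed
  by \<open>D\<close>, so the proof compares three frames: the given one, the frame of \<open>D\<close>, and the frame of
  \<open>T\<^sub>x\<close> in which \<open>x\<close> becomes the unit \<open>e\<close>. The comparison rests on an invariant. In the Clifford algebra
  of one block, where \<open>p = (p\<^sub>0, u)\<close> is the sum of a scalar and a vector, the product \<open>x s\<close> has the
  Jordan product \<open>x \<circ> s\<close> as its scalar-plus-vector part and the wedge product of the two tails as its
  bivector part. A matrix \<open>D\<close> in \<open>\<G>\<close> acts on each block, up to a positive factor, by a Lorentz transformation, and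
  passing from \<open>x\<close>, \<open>s\<close> to \<open>D\<^sup>-\<^sup>T x\<close>, \<open>D s\<close> changes the product \<open>x s\<close> only by an automorphism of the algebra.
  Hence the scalar part of
  \<open>(x t + y s - c)\<^sup>2\<close>, called \<open>defect\<close> below, does not depend on the frame. It equals the squared norm of
  the symmetric part \<open>x \<circ> t + y \<circ> s - c e\<close> minus that of the bivector part
  (\<open>defect_eq_symmetric_minus_wedge\<close>).

  The Newton equation says that the symmetric part for \<open>(x, s + ds, dx, s)\<close> and \<open>c = \<nu>\<mu>\<close> vanishes
  in the frame of \<open>D\<close>, so the defect is nonpositive in every frame, whatever \<open>D\<close> is. In the frame of
  \<open>T\<^sub>x\<close>, with \<open>w = T\<^sub>x s\<close>, the bivector part is the single wedge product of the tails of \<open>dx\<close> and \<open>w\<close>,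
  which is at most \<open>\<gamma>\<mu> \<parallel>dx\<parallel>\<close> because \<open>w\<close> is within \<open>\<gamma>\<mu>\<close> of \<open>\<mu>e\<close>. There the Newton equation therefore
  holds up to a small error, which gives
  \<open>ds + \<mu> dx = \<nu>\<mu>e - w + O(\<gamma>\<mu> \<parallel>dx\<parallel>)\<close>. The scaled \<open>dx\<close> and \<open>ds\<close> are orthogonal, because the
  homogeneous system of residuals is skew-symmetric, so \<open>\<mu> dx\<close> and \<open>ds\<close> both have size at most
  \<open>\<surd>(\<gamma>\<^sup>2 + \<delta>\<^sup>2) \<mu> / (1 - 3\<gamma>)\<close>, up to a constant.

  Two conclusions follow (\<open>scaled_short_step\<close>). The steps are small enough to stay in the interior of
  the cone. Moreover, \<open>\<parallel>T\<^sub>x s - c e\<parallel>\<^sup>2\<close> is itself a defect, with only one product; at the new point it is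
  bounded by the squared norm of the symmetric part, which is the error above plus the second-order term
  \<open>dx \<circ> ds\<close>. Both are of order \<open>(\<gamma>\<^sup>2 + \<delta>\<^sup>2) \<mu> / (1 - 3\<gamma>)\<^sup>2\<close>, and the assumption on \<open>\<gamma>\<close> and \<open>\<delta>\<close> makes
  this smaller than \<open>\<gamma>\<nu>\<mu>\<close>. The pair \<open>(\<kappa>, \<tau>)\<close> takes part in all of this as one more,
  one-dimensional, block. The laws for the residuals and for \<open>\<mu>\<close> are linear algebra, \<open>\<mu>\<close> using the
  orthogonality once more.
\<close>

section \<open>The spin factor and its Lorentz form\<close>

definition lorentz :: "real \<times> 'v::real_inner \<Rightarrow> real \<times> 'v \<Rightarrow> real" where
  "lorentz p q = fst p * fst q - snd p \<bullet> snd q"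

definition jprod :: "real \<times> 'v::real_inner \<Rightarrow> real \<times> 'v \<Rightarrow> real \<times> 'v" where
  "jprod p q = (p \<bullet> q, fst p *\<^sub>R snd q + fst q *\<^sub>R snd p)"

definition in_cone_interior :: "real \<times> 'v::real_inner \<Rightarrow> bool" where
  "in_cone_interior p \<longleftrightarrow> norm (snd p) < fst p"

abbreviation spin_unit :: "real \<times> 'v::real_inner" where
  "spin_unit \<equiv> (1, 0)"

lemma jprod_unit_left [simp]: "jprod spin_unit p = p"
  by (simp add: jprod_def inner_prod_def prod_eq_iff)

lemma jprod_add_left: "jprod (p + q) r = jprod p r + jprod q r"
  and jprod_add_right: "jprod p (q + r) = jprod p q + jprod p r"
  by (simp_all add: jprod_def inner_prod_def prod_eq_iff algebra_simps)

lemma jprod_diff_right: "jprod p (q - r) = jprod p q - jprod p r"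
  by (simp add: jprod_def inner_prod_def prod_eq_iff algebra_simps)

lemma jprod_scaled_unit_right: "jprod p (c *\<^sub>R spin_unit) = c *\<^sub>R p"
  by (simp add: jprod_def inner_prod_def prod_eq_iff algebra_simps)

lemma jprod_commute: "jprod p q = jprod q p"
  by (simp add: jprod_def inner_commute add.commute)

lemma norm_prod_power2: "(norm p)\<^sup>2 = (fst p)\<^sup>2 + (norm (snd p))\<^sup>2"
  for p :: "real \<times> 'v::real_inner"
  by (simp add: norm_prod_def)

lemma norm_snd_le_norm: "norm (snd p) \<le> norm p"
  for p :: "real \<times> 'v::real_inner"
  by (simp add: norm_prod_def)

lemma norm_jprod_le: "norm (jprod p q) \<le> sqrt 2 * (norm p * norm q)"
proof -
  obtain a u where p: "p = (a, u)" by (cases p)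
  obtain b v where q: "q = (b, v)" by (cases q)
  let ?U = "norm u" and ?V = "norm v"
  have cs: "\<bar>u \<bullet> v\<bar> \<le> ?U * ?V" by (rule Cauchy_Schwarz_ineq2)
  have "(norm (jprod p q))\<^sup>2 = (a * b + u \<bullet> v)\<^sup>2 + (norm (a *\<^sub>R v + b *\<^sub>R u))\<^sup>2"
    by (simp add: p q jprod_def norm_prod_def inner_prod_def)
  also have "\<dots> = (a * b)\<^sup>2 + (u \<bullet> v)\<^sup>2 + a\<^sup>2 * ?V\<^sup>2 + b\<^sup>2 * ?U\<^sup>2 + 4 * (a * b) * (u \<bullet> v)"
    unfolding power2_norm_eq_inner
    by (simp add: inner_add_left inner_add_right inner_commute power2_eq_square algebra_simps)
  also have "\<dots> \<le> (a * b)\<^sup>2 + (?U * ?V)\<^sup>2 + a\<^sup>2 * ?V\<^sup>2 + b\<^sup>2 * ?U\<^sup>2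
      + 4 * \<bar>a * b\<bar> * (?U * ?V)"
  proof -
    have "(u \<bullet> v)\<^sup>2 \<le> (?U * ?V)\<^sup>2" using cs by (simp add: abs_le_square_iff[symmetric])
    moreover have "(a * b) * (u \<bullet> v) \<le> \<bar>a * b\<bar> * (?U * ?V)"
      using abs_ge_self[of "(a * b) * (u \<bullet> v)"] mult_left_mono[OF cs abs_ge_zero[of "a * b"]]
      by (simp only: abs_mult)
    ultimately show ?thesis by linarith
  qed
  also have "\<dots> \<le> 2 * ((a\<^sup>2 + ?U\<^sup>2) * (b\<^sup>2 + ?V\<^sup>2))"
  proof -
    have "0 \<le> (\<bar>a * b\<bar> - ?U * ?V)\<^sup>2 + (\<bar>a\<bar> * ?V - \<bar>b\<bar> * ?U)\<^sup>2" by simp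
    then show ?thesis
      by (simp add: power2_eq_square abs_mult algebra_simps)
  qed
  also have "\<dots> = (sqrt 2 * (norm p * norm q))\<^sup>2"
    by (simp add: power_mult_distrib norm_prod_power2 p q)
  finally show ?thesis by (rule power2_le_imp_le) simp
qed

text \<open>
  The expression is the squared norm of the bivector \<open>x \<and> t + y \<and> s\<close>, hence half the sum of the
  squares of the entries of its skew-symmetric coordinate matrix.
\<close>

lemma wedge_sum_nonneg:
  fixes x t y s :: "'v::euclidean_space"
  shows "0 \<le> ((x \<bullet> x) * (t \<bullet> t) - (x \<bullet> t)\<^sup>2) + 2 * ((x \<bullet> y) * (t \<bullet> s) - (x \<bullet> s) * (t \<bullet> y))
           + ((y \<bullet> y) * (s \<bullet> s) - (y \<bullet> s)\<^sup>2)" (is "0 \<le> ?w")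
proof -
  let ?c = "\<lambda>a b. (x \<bullet> a) * (t \<bullet> b) - (t \<bullet> a) * (x \<bullet> b) + (y \<bullet> a) * (s \<bullet> b) - (s \<bullet> a) * (y \<bullet> b)"
  have prod: "(p \<bullet> q) * (r \<bullet> z) = (\<Sum>a\<in>Basis. \<Sum>b\<in>Basis. (p \<bullet> a) * (q \<bullet> a) * ((r \<bullet> b) * (z \<bullet> b)))"
    for p q r z :: 'v
    by (simp add: euclidean_inner[of p q] euclidean_inner[of r z] sum_product)
  have "2 * ?w = (\<Sum>a\<in>Basis. \<Sum>b\<in>Basis. (?c a b)\<^sup>2)"
  proof -
    have "(\<Sum>a\<in>Basis. \<Sum>b\<in>Basis. (?c a b)\<^sup>2) =
      (x \<bullet> x) * (t \<bullet> t) + (t \<bullet> t) * (x \<bullet> x) - 2 * ((x \<bullet> t) * (x \<bullet> t))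
      + 2 * ((x \<bullet> y) * (t \<bullet> s)) + 2 * ((t \<bullet> s) * (x \<bullet> y)) - 2 * ((x \<bullet> s) * (t \<bullet> y))
      - 2 * ((t \<bullet> y) * (x \<bullet> s)) + (y \<bullet> y) * (s \<bullet> s) + (s \<bullet> s) * (y \<bullet> y) - 2 * ((y \<bullet> s) * (y \<bullet> s))"
      unfolding prod[of x x t t] prod[of t t x x] prod[of x t x t] prod[of x y t s] prod[of t s x y]
        prod[of x s t y] prod[of t y x s] prod[of y y s s] prod[of s s y y] prod[of y s y s]
        sum_distrib_left sum.distrib[symmetric] sum_subtractf[symmetric]
      by (intro sum.cong refl) (simp add: power2_eq_square algebra_simps)
    then show ?thesis by (simp add: power2_eq_square algebra_simps)
  qed
  moreover have "0 \<le> (\<Sum>a\<in>Basis. \<Sum>b\<in>Basis. (?c a b)\<^sup>2)"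
    by (intro sum_nonneg) simp
  ultimately show ?thesis by simp
qed

section \<open>A frame-independent measure of centrality\<close>

text \<open>
  In the Clifford algebra of \<open>\<real> \<times> V\<close> this is the scalar part of \<open>(x t + y s - c)\<^sup>2\<close>. It is written through
  pairings of a primal with a dual vector and through products of a primal with a dual Lorentz form,
  which are exactly the quantities preserved by a scaling of \<open>x, y\<close> and the inverse scaling of \<open>t, s\<close>.
\<close>

definition defect ::
  "real \<Rightarrow> real \<times> 'v::real_inner \<Rightarrow> real \<times> 'v \<Rightarrow> real \<times> 'v \<Rightarrow> real \<times> 'v \<Rightarrow> real" where
  "defect c x t y s =
     (2 * (x \<bullet> t)\<^sup>2 - lorentz x x * lorentz t t)
     + 2 * ((x \<bullet> t) * (y \<bullet> s) + (x \<bullet> s) * (y \<bullet> t) - lorentz x y * lorentz t s)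
     + (2 * (y \<bullet> s)\<^sup>2 - lorentz y y * lorentz s s)
     - 2 * c * (x \<bullet> t + y \<bullet> s) + c\<^sup>2"

text \<open>
  For \<open>x\<close> in the interior of the cone this is \<open>\<parallel>T\<^sub>x s - c e\<parallel>\<^sup>2\<close> (see \<open>gap_spin_T\<close>); the
  present form makes its invariance under scaling visible.
\<close>

definition gap :: "real \<Rightarrow> real \<times> 'v::real_inner \<Rightarrow> real \<times> 'v \<Rightarrow> real" where
  "gap c x s = 2 * (x \<bullet> s)\<^sup>2 - lorentz x x * lorentz s s - 2 * c * (x \<bullet> s) + c\<^sup>2"

lemma gap_eq_defect: "gap c x s = defect c x s 0 0"
  by (simp add: gap_def defect_def lorentz_def)

text \<open>
  The square of scalar plus vector contributes its squared norm to the scalar part, and the square of a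
  bivector contributes the negative of its squared norm.
\<close>

lemma defect_eq_symmetric_minus_wedge:
  "defect c x t y s = (norm (jprod x t + jprod y s - c *\<^sub>R spin_unit))\<^sup>2
     - (((snd x \<bullet> snd x) * (snd t \<bullet> snd t) - (snd x \<bullet> snd t)\<^sup>2)
        + 2 * ((snd x \<bullet> snd y) * (snd t \<bullet> snd s) - (snd x \<bullet> snd s) * (snd t \<bullet> snd y))
        + ((snd y \<bullet> snd y) * (snd s \<bullet> snd s) - (snd y \<bullet> snd s)\<^sup>2))"
proof -
  obtain x0 xv where x: "x = (x0, xv)" by (cases x)
  obtain t0 tv where t: "t = (t0, tv)" by (cases t)
  obtain y0 yv where y: "y = (y0, yv)" by (cases y)
  obtain s0 sv where s: "s = (s0, sv)" by (cases s)
  show ?thesis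
    unfolding x t y s defect_def lorentz_def jprod_def power2_norm_eq_inner
    by (simp add: inner_prod_def inner_add_left inner_add_right inner_commute[of tv xv]
        inner_commute[of yv xv] inner_commute[of sv xv] inner_commute[of yv tv]
        inner_commute[of sv tv] inner_commute[of sv yv] power2_eq_square algebra_simps)
qed

section \<open>The scaling that takes an interior point to the unit\<close>

text \<open>
  The matrix $T_u$ of one block as an operator: it is the positive definite square root of the
  quadratic representation of \<open>p\<close>.
\<close>

definition spin_T :: "real \<times> 'v::real_inner \<Rightarrow> real \<times> 'v \<Rightarrow> real \<times> 'v" where
  "spin_T p q = (let \<beta> = sqrt (lorentz p p) in
     (p \<bullet> q, fst q *\<^sub>R snd p + \<beta> *\<^sub>R snd q + ((snd p \<bullet> snd q) / (\<beta> + fst p)) *\<^sub>R snd p))"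

text \<open>
  With the reflection \<open>R (a, u) = (a, - u)\<close>, the operator \<open>T\<^sub>p\<close> satisfies \<open>T\<^sub>p R T\<^sub>p = lorentz p p R\<close>, so its
  inverse is \<open>R T\<^sub>p R\<close> divided by \<open>lorentz p p\<close>.
\<close>

definition spin_T_inv :: "real \<times> 'v::real_inner \<Rightarrow> real \<times> 'v \<Rightarrow> real \<times> 'v" where
  "spin_T_inv p q = (let r = spin_T p (fst q, - snd q)
     in inverse (lorentz p p) *\<^sub>R (fst r, - snd r))"

lemma lorentz_pos: "in_cone_interior p \<Longrightarrow> in_cone_interior q \<Longrightarrow> 0 < lorentz p q"
proof -
  assume "in_cone_interior p" "in_cone_interior q"
  then have "norm (snd p) * norm (snd q) < fst p * fst q"
    unfolding in_cone_interior_def by (intro mult_strict_mono) (auto intro: le_less_trans[OF norm_ge_zero])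
  moreover have "snd p \<bullet> snd q \<le> norm (snd p) * norm (snd q)" by (rule norm_cauchy_schwarz)
  ultimately show ?thesis unfolding lorentz_def by linarith
qed

lemma inner_pos: "in_cone_interior p \<Longrightarrow> in_cone_interior q \<Longrightarrow> 0 < p \<bullet> q"
  using lorentz_pos[of p "(fst q, - snd q)"]
  by (simp add: in_cone_interior_def lorentz_def inner_prod_def)

text \<open>
  A vector of positive Lorentz square lies in the interior of the cone or of its negative; a positive
  Lorentz product with an interior point excludes the negative. This criterion carries interiority from
  one frame to another.
\<close>

lemma in_cone_interior_if_lorentz_pos:
  assumes p: "in_cone_interior p" and q: "0 < lorentz q q" and pq: "0 < lorentz p q"
  shows "in_cone_interior q"
proof -
  have p': "norm (snd p) < fst p" using p by (simp add: in_cone_interior_def)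
  have "(norm (snd q))\<^sup>2 < (fst q)\<^sup>2"
    using q by (simp add: lorentz_def dot_square_norm power2_eq_square)
  then have q': "norm (snd q) < \<bar>fst q\<bar>"
    by (simp add: power2_less_imp_less)
  have "0 \<le> fst q"
  proof (rule ccontr)
    assume "\<not> 0 \<le> fst q"
    then have n: "norm (snd q) < - fst q" using q' by simp
    have "norm (snd p) * norm (snd q) \<le> fst p * (- fst q)"
      by (rule mult_mono) (use p' n norm_ge_zero[of "snd p"] norm_ge_zero[of "snd q"] in linarith)+
    moreover have "- (snd p \<bullet> snd q) \<le> norm (snd p) * norm (snd q)"
      using Cauchy_Schwarz_ineq2[of "snd p" "snd q"] by linarith
    ultimately show False using pq by (simp add: lorentz_def)
  qed
  then show ?thesis using q' by (simp add: in_cone_interior_def)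
qed

text \<open>
  The distance from \<open>r e\<close> to the boundary of the cone is \<open>r / \<surd>2\<close>.
\<close>

lemma in_cone_interior_near_unit:
  assumes "2 * (norm (q - r *\<^sub>R spin_unit))\<^sup>2 < r\<^sup>2" and "0 < r"
  shows "in_cone_interior q"
proof -
  let ?h = "fst q - r" and ?n = "norm (snd q)"
  have "(norm (q - r *\<^sub>R spin_unit))\<^sup>2 = ?h\<^sup>2 + ?n\<^sup>2"
    by (simp add: norm_prod_power2)
  moreover have "(?n - ?h)\<^sup>2 \<le> 2 * (?h\<^sup>2 + ?n\<^sup>2)"
    using zero_le_power2[of "?n + ?h"] by (simp add: power2_eq_square algebra_simps)
  ultimately have "(?n - ?h)\<^sup>2 < r\<^sup>2" using assms(1) by simp
  then have "?n - ?h < r" using assms(2) by (simp add: power2_less_imp_less)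
  then show ?thesis by (simp add: in_cone_interior_def)
qed

text \<open>
  Up to the factor \<open>\<beta> = \<surd>(lorentz p p)\<close>, the operator \<open>T\<^sub>p\<close> is the Lorentz boost that takes \<open>e\<close> to
  \<open>p / \<beta>\<close>.
\<close>

lemma lorentz_spin_T:
  assumes "in_cone_interior p"
  shows "lorentz (spin_T p q) (spin_T p r) = lorentz p p * lorentz q r"
proof -
  obtain x w where p: "p = (x, w)" by (cases p)
  obtain a u where q: "q = (a, u)" by (cases q)
  obtain b v where r: "r = (b, v)" by (cases r)
  define \<beta> where "\<beta> = sqrt (lorentz p p)"
  define k where "k = 1 / (\<beta> + x)"
  have pos: "0 < lorentz p p" using assms lorentz_pos by blast
  then have \<beta>: "0 < \<beta>" "\<beta>\<^sup>2 = x\<^sup>2 - w \<bullet> w"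
    by (auto simp: \<beta>_def) (simp add: p lorentz_def power2_eq_square)
  have x: "0 < x" using assms le_less_trans[OF norm_ge_zero[of w]] by (simp add: p in_cone_interior_def)
  have k1: "k * (\<beta> + x) = 1" using \<beta> x by (simp add: k_def)
  have w: "w \<bullet> w = (x - \<beta>) * (x + \<beta>)" using \<beta> by (simp add: power2_eq_square algebra_simps)
  have k2: "k * (w \<bullet> w) = x - \<beta>"
  proof -
    have "k * (w \<bullet> w) = (x - \<beta>) * (k * (\<beta> + x))" unfolding w by (simp add: algebra_simps)
    then show ?thesis by (simp add: k1)
  qed
  have T: "spin_T p q = (x * a + w \<bullet> u, a *\<^sub>R w + \<beta> *\<^sub>R u + (k * (w \<bullet> u)) *\<^sub>R w)"
    "spin_T p r = (x * b + w \<bullet> v, b *\<^sub>R w + \<beta> *\<^sub>R v + (k * (w \<bullet> v)) *\<^sub>R w)"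
    unfolding spin_T_def Let_def \<beta>_def[symmetric] k_def by (simp_all add: p q r inner_prod_def)
  have "lorentz (spin_T p q) (spin_T p r) = (x * a + w \<bullet> u) * (x * b + w \<bullet> v)
     - (a * b * (w \<bullet> w) + a * \<beta> * (w \<bullet> v) + a * (w \<bullet> v) * (k * (w \<bullet> w))
        + \<beta> * b * (w \<bullet> u) + \<beta>\<^sup>2 * (u \<bullet> v) + \<beta> * k * (w \<bullet> u) * (w \<bullet> v)
        + b * (w \<bullet> u) * (k * (w \<bullet> w)) + \<beta> * k * (w \<bullet> u) * (w \<bullet> v)
        + k * (w \<bullet> u) * (w \<bullet> v) * (k * (w \<bullet> w)))"
    unfolding T lorentz_def
    by (simp add: inner_add_left inner_add_right inner_commute[of u w] inner_commute[of v w]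
        power2_eq_square algebra_simps)
  also have "\<dots> = (x\<^sup>2 - w \<bullet> w) * (a * b) - \<beta>\<^sup>2 * (u \<bullet> v)
      + (w \<bullet> u) * (w \<bullet> v) * (1 - k * (\<beta> + x))"
    unfolding k2 by (simp add: power2_eq_square algebra_simps)
  also have "\<dots> = lorentz p p * lorentz q r"
    unfolding k1 \<beta>(2)
    by (simp add: lorentz_def q r p power2_eq_square algebra_simps)
  finally show ?thesis .
qed

lemma spin_T_self_adjoint: "spin_T p q \<bullet> r = q \<bullet> spin_T p r"
  by (simp add: spin_T_def Let_def inner_prod_def inner_add_left inner_add_right
      inner_commute[of "snd q"] algebra_simps)

lemma spin_T_unit: "in_cone_interior p \<Longrightarrow> spin_T p spin_unit = p"
  by (simp add: spin_T_def inner_prod_def prod_eq_iff)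

lemma spin_T_add: "spin_T p (q + r) = spin_T p q + spin_T p r"
  by (simp add: spin_T_def Let_def inner_add_right add_divide_distrib algebra_simps)

lemma spin_T_inv_inner:
  assumes "in_cone_interior p"
  shows "spin_T_inv p a \<bullet> spin_T p b = a \<bullet> b"
proof -
  have "spin_T_inv p a \<bullet> spin_T p b
      = inverse (lorentz p p) * lorentz (spin_T p (fst a, - snd a)) (spin_T p b)"
    by (simp add: spin_T_inv_def Let_def lorentz_def inner_prod_def algebra_simps)
  also have "\<dots> = lorentz (fst a, - snd a) b"
    using lorentz_pos[OF assms assms] by (simp add: lorentz_spin_T[OF assms])
  finally show ?thesis by (simp add: lorentz_def inner_prod_def)
qed

lemma lorentz_spin_T_inv:
  assumes "in_cone_interior p"
  shows "lorentz (spin_T_inv p a) (spin_T_inv p b) = inverse (lorentz p p) * lorentz a b"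
proof -
  have "lorentz (spin_T_inv p a) (spin_T_inv p b) = (inverse (lorentz p p))\<^sup>2
      * lorentz (spin_T p (fst a, - snd a)) (spin_T p (fst b, - snd b))"
    by (simp add: spin_T_inv_def Let_def lorentz_def power2_eq_square algebra_simps)
  also have "\<dots> = inverse (lorentz p p) * lorentz a b"
    using lorentz_pos[OF assms assms]
    by (simp add: lorentz_spin_T[OF assms] power2_eq_square) (simp add: lorentz_def)
  finally show ?thesis .
qed

lemma lorentz_spin_T_inv_times_spin_T:
  assumes "in_cone_interior p"
  shows "lorentz (spin_T_inv p a) (spin_T_inv p b) * lorentz (spin_T p q) (spin_T p r)
    = lorentz a b * lorentz q r"
  using lorentz_pos[OF assms assms] by (simp add: lorentz_spin_T[OF assms] lorentz_spin_T_inv[OF assms])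

lemma defect_spin_T:
  assumes "in_cone_interior p"
  shows "defect c (spin_T_inv p x) (spin_T p t) (spin_T_inv p y) (spin_T p s) = defect c x t y s"
  by (simp only: defect_def spin_T_inv_inner[OF assms] lorentz_spin_T_inv_times_spin_T[OF assms])

lemma gap_spin_T_invariant:
  assumes "in_cone_interior p"
  shows "gap c (spin_T_inv p x) (spin_T p s) = gap c x s"
  by (simp only: gap_def spin_T_inv_inner[OF assms] lorentz_spin_T_inv_times_spin_T[OF assms])

text \<open>
  By duality \<open>T\<^sub>p\<^sup>-\<^sup>1 p - e\<close> is orthogonal to the range of \<open>T\<^sub>p\<close>, which is everything.
\<close>

lemma spin_T_inv_self:
  assumes "in_cone_interior p"
  shows "spin_T_inv p p = spin_unit"
proof -
  have "\<exists>b. spin_T p b = z" for z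
  proof -
    have "r \<bullet> spin_T p (spin_T_inv p z) = r \<bullet> z" for r
      using spin_T_inv_inner[OF assms, of z r] by (simp add: spin_T_self_adjoint inner_commute)
    then show ?thesis by (metis vector_eq_rdot inner_commute)
  qed
  then obtain b where b: "spin_T p b = spin_T_inv p p - spin_unit" by metis
  have "(spin_T_inv p p - spin_unit) \<bullet> spin_T p b = p \<bullet> b - spin_T p spin_unit \<bullet> b"
    by (simp add: inner_diff_left spin_T_inv_inner[OF assms] spin_T_self_adjoint)
  also have "\<dots> = 0" by (simp add: spin_T_unit[OF assms])
  finally show ?thesis using b by simp
qed

lemma spin_T_inv_add: "spin_T_inv p (q + r) = spin_T_inv p q + spin_T_inv p r"
proof -
  have "spin_T p (fst (q + r), - snd (q + r)) = spin_T p (fst q, - snd q) + spin_T p (fst r, - snd r)"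
    by (simp add: spin_T_add[symmetric])
  then show ?thesis
    by (simp add: spin_T_inv_def Let_def prod_eq_iff algebra_simps)
qed

lemma gap_spin_T:
  assumes "in_cone_interior p"
  shows "gap c p q = (norm (spin_T p q - c *\<^sub>R spin_unit))\<^sup>2"
proof -
  have "gap c p q = gap c spin_unit (spin_T p q)"
    using gap_spin_T_invariant[OF assms, of c p q]
    by (simp add: spin_T_inv_self[OF assms])
  also have "\<dots> = (norm (spin_T p q - c *\<^sub>R spin_unit))\<^sup>2"
    by (simp add: gap_eq_defect defect_eq_symmetric_minus_wedge jprod_def[of 0]
        zero_prod_def[symmetric])
  finally show ?thesis .
qed

section \<open>One short step in a product of spin factors\<close>

lemma gap_le_norm_jprod:
  fixes p q :: "real \<times> 'v::euclidean_space"
  shows "gap c p q \<le> (norm (jprod p q - c *\<^sub>R spin_unit))\<^sup>2"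
proof -
  have "0 \<le> (snd p \<bullet> snd p) * (snd q \<bullet> snd q) - (snd p \<bullet> snd q)\<^sup>2"
    using Cauchy_Schwarz_ineq[of "snd p" "snd q"] by simp
  then show ?thesis
    by (simp add: gap_eq_defect defect_eq_symmetric_minus_wedge jprod_def[of 0] zero_prod_def[symmetric])
qed

text \<open>
  The situation of one block in the frame where \<open>x = e\<close>: \<open>w\<close>, \<open>y\<close>, \<open>d\<close> are the images of \<open>s\<close>, \<open>dx\<close>, \<open>ds\<close>. As
  \<open>e\<close> has no tail, the bivector part of \<open>e (w + d) + y w\<close> is the wedge product of the tails of \<open>y\<close> and
  \<open>w\<close>, so a nonpositive defect bounds the residual \<open>E\<close> of the Newton equation in this frame. The first
  estimate solves that equation for \<open>d + m y\<close>; the second adds the second-order term \<open>y \<circ> d\<close> to \<open>E\<close>.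
\<close>

lemma scaled_block_estimates:
  fixes w y d :: "real \<times> 'v::euclidean_space"
  assumes newton: "defect c spin_unit (w + d) y w \<le> 0"
    and near: "sqrt 2 * norm (w - m *\<^sub>R spin_unit) \<le> \<gamma> * m"
  shows "norm (d + m *\<^sub>R y) \<le> norm (w - c *\<^sub>R spin_unit) + 2 * \<gamma> * (m * norm y)"
    and "gap c (spin_unit + y) (w + d) \<le> (norm y * (\<gamma> * m + sqrt 2 * norm d))\<^sup>2"
proof -
  define E where "E = w + d + jprod y w - c *\<^sub>R spin_unit"
  have near': "norm (w - m *\<^sub>R spin_unit) \<le> \<gamma> * m"
  proof -
    have "norm (w - m *\<^sub>R spin_unit) \<le> sqrt 2 * norm (w - m *\<^sub>R spin_unit)"
      using mult_right_mono[of 1 "sqrt 2" "norm (w - m *\<^sub>R spin_unit)"] by simp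
    with near show ?thesis by linarith
  qed
  have "(norm E)\<^sup>2 \<le> (norm (snd y) * norm (snd w))\<^sup>2"
  proof -
    have "(norm E)\<^sup>2 = defect c spin_unit (w + d) y w
        + ((snd y \<bullet> snd y) * (snd w \<bullet> snd w) - (snd y \<bullet> snd w)\<^sup>2)"
      by (simp add: defect_eq_symmetric_minus_wedge E_def)
    also have "\<dots> \<le> (snd y \<bullet> snd y) * (snd w \<bullet> snd w)"
      using newton zero_le_power2[of "snd y \<bullet> snd w"] by linarith
    finally show ?thesis by (simp add: dot_square_norm power_mult_distrib)
  qed
  then have "norm E \<le> norm (snd y) * norm (snd w)" by (rule power2_le_imp_le) simp
  \<comment> \<open>The tail of \<open>w\<close> is also the tail of \<open>w - m e\<close>.\<close>
  also have "\<dots> \<le> norm y * norm (w - m *\<^sub>R spin_unit)"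
    using norm_snd_le_norm[of y] norm_snd_le_norm[of "w - m *\<^sub>R spin_unit"]
    by (intro mult_mono) simp_all
  also have "\<dots> \<le> norm y * (\<gamma> * m)" using near' by (intro mult_left_mono) simp_all
  finally have E: "norm E \<le> norm y * (\<gamma> * m)" .
  have "norm (jprod y (w - m *\<^sub>R spin_unit)) \<le> norm y * (sqrt 2 * norm (w - m *\<^sub>R spin_unit))"
    using norm_jprod_le[of y "w - m *\<^sub>R spin_unit"] by (simp only: mult.left_commute)
  also have "\<dots> \<le> norm y * (\<gamma> * m)" using near by (intro mult_left_mono) simp_all
  finally have J: "norm (jprod y (w - m *\<^sub>R spin_unit)) \<le> norm y * (\<gamma> * m)" .
  have "d + m *\<^sub>R y = E - (w - c *\<^sub>R spin_unit) - jprod y (w - m *\<^sub>R spin_unit)"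
    unfolding E_def jprod_diff_right jprod_scaled_unit_right by (simp add: algebra_simps)
  then have "norm (d + m *\<^sub>R y) \<le> norm E + norm (w - c *\<^sub>R spin_unit)
      + norm (jprod y (w - m *\<^sub>R spin_unit))"
    using norm_triangle_ineq4[of "E - (w - c *\<^sub>R spin_unit)" "jprod y (w - m *\<^sub>R spin_unit)"]
      norm_triangle_ineq4[of E "w - c *\<^sub>R spin_unit"]
    by (simp only:)
  then show "norm (d + m *\<^sub>R y) \<le> norm (w - c *\<^sub>R spin_unit) + 2 * \<gamma> * (m * norm y)"
    using E J by (simp add: algebra_simps)
  have eq: "jprod (spin_unit + y) (w + d) - c *\<^sub>R spin_unit = E + jprod y d"
    by (simp add: E_def jprod_add_left jprod_add_right)
  have "norm (E + jprod y d) \<le> norm y * (\<gamma> * m + sqrt 2 * norm d)"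
    using norm_triangle_ineq[of E "jprod y d"] E norm_jprod_le[of y d]
    by (simp add: algebra_simps)
  then have "(norm (E + jprod y d))\<^sup>2 \<le> (norm y * (\<gamma> * m + sqrt 2 * norm d))\<^sup>2"
    by (intro power_mono) simp_all
  then show "gap c (spin_unit + y) (w + d) \<le> (norm y * (\<gamma> * m + sqrt 2 * norm d))\<^sup>2"
    using gap_le_norm_jprod[of c "spin_unit + y" "w + d"] unfolding eq by linarith
qed

text \<open>
  Here \<open>a\<close> is the norm of \<open>d + m y\<close> over all blocks. Since \<open>y\<close> and \<open>d\<close> are orthogonal, \<open>a\<close> dominates both
  \<open>m \<parallel>y\<parallel>\<close> and \<open>\<parallel>d\<parallel>\<close>, so the first block estimate bounds \<open>a\<close> in terms of itself and can be solved for
  \<open>a\<close>. The hypothesis on \<open>\<delta>\<close> is the contribution of replacing the target \<open>m\<close> by \<open>\<nu> m\<close> to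
  \<open>\<Sum> \<parallel>w - \<nu> m e\<parallel>\<^sup>2\<close>, the two parts being orthogonal by the trace condition.
\<close>

lemma scaled_short_step:
  fixes w y d :: "'i::finite \<Rightarrow> real \<times> 'v::euclidean_space"
  assumes m: "0 < m" and \<gamma>: "0 < \<gamma>" "\<gamma> < 1 / 3" and \<nu>: "0 < \<nu>" "\<nu> < 1"
    and \<nu>_\<delta>: "(1 - \<nu>)\<^sup>2 * real CARD('i) = \<delta>\<^sup>2 / 2"
    and parameters: "4 * (\<gamma>\<^sup>2 + \<delta>\<^sup>2) / (1 - 3 * \<gamma>)\<^sup>2 < \<gamma> * \<nu>"
    and trace: "(\<Sum>i\<in>UNIV. fst (w i)) = real CARD('i) * m"
    and near: "(\<Sum>i\<in>UNIV. (norm (w i - m *\<^sub>R spin_unit))\<^sup>2) \<le> \<gamma>\<^sup>2 * m\<^sup>2 / 2"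
    and newton: "\<And>i. defect (\<nu> * m) spin_unit (w i + d i) (y i) (w i) \<le> 0"
    and orth: "(\<Sum>i\<in>UNIV. y i \<bullet> d i) = 0"
  shows "(\<Sum>i\<in>UNIV. gap (\<nu> * m) (spin_unit + y i) (w i + d i)) \<le> \<gamma>\<^sup>2 * (\<nu> * m)\<^sup>2 / 2"
    and "in_cone_interior (spin_unit + y i)" and "in_cone_interior (w i + d i)"
proof -
  define c where "c = \<nu> * m"
  define Y where "Y = L2_set (\<lambda>i. norm (y i)) UNIV"
  define D where "D = L2_set (\<lambda>i. norm (d i)) UNIV"
  define B where "B = L2_set (\<lambda>i. norm (w i - c *\<^sub>R spin_unit)) UNIV"
  define a where "a = L2_set (\<lambda>i. norm (d i + m *\<^sub>R y i)) UNIV"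
  define \<rho> where "\<rho> = (\<gamma>\<^sup>2 + \<delta>\<^sup>2) / (1 - 3 * \<gamma>)\<^sup>2"
  have nn: "0 \<le> Y" "0 \<le> D" "0 \<le> B" "0 \<le> a" by (simp_all add: Y_def D_def B_def a_def)
  have near_i: "2 * (norm (w i - m *\<^sub>R spin_unit))\<^sup>2 \<le> (\<gamma> * m)\<^sup>2" for i
  proof -
    have "(norm (w i - m *\<^sub>R spin_unit))\<^sup>2 \<le> (\<Sum>i\<in>UNIV. (norm (w i - m *\<^sub>R spin_unit))\<^sup>2)"
      by (rule member_le_sum) simp_all
    then show ?thesis using near by (simp add: power_mult_distrib)
  qed
  have near_sqrt: "sqrt 2 * norm (w i - m *\<^sub>R spin_unit) \<le> \<gamma> * m" for i
    by (rule power2_le_imp_le) (use near_i[of i] m \<gamma> in \<open>simp_all add: power_mult_distrib\<close>)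
  have B2: "B\<^sup>2 \<le> (\<gamma>\<^sup>2 + \<delta>\<^sup>2) * m\<^sup>2 / 2"
  proof -
    have term_i: "(norm (w i - c *\<^sub>R spin_unit))\<^sup>2 = (norm (w i - m *\<^sub>R spin_unit))\<^sup>2
        + (2 * (m - c) * fst (w i) - (m\<^sup>2 - c\<^sup>2))" for i
      unfolding norm_prod_power2 by (simp add: power2_eq_square algebra_simps)
    have "B\<^sup>2 = (\<Sum>i\<in>UNIV. (norm (w i - c *\<^sub>R spin_unit))\<^sup>2)"
      by (simp add: B_def L2_set_def sum_nonneg)
    also have "\<dots> = (\<Sum>i\<in>UNIV. (norm (w i - m *\<^sub>R spin_unit))\<^sup>2)
        + (2 * (m - c) * (real CARD('i) * m) - real CARD('i) * (m\<^sup>2 - c\<^sup>2))"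
      unfolding term_i by (simp add: sum.distrib sum_subtractf sum_distrib_left[symmetric] trace)
    also have "\<dots> = (\<Sum>i\<in>UNIV. (norm (w i - m *\<^sub>R spin_unit))\<^sup>2)
        + ((1 - \<nu>)\<^sup>2 * real CARD('i)) * m\<^sup>2"
      by (simp add: c_def power2_eq_square algebra_simps)
    finally show ?thesis using near unfolding \<nu>_\<delta> by (simp add: field_simps)
  qed
  have a2: "a\<^sup>2 = (m * Y)\<^sup>2 + D\<^sup>2"
  proof -
    have "a\<^sup>2 = (\<Sum>i\<in>UNIV. (norm (d i + m *\<^sub>R y i))\<^sup>2)"
      by (simp add: a_def L2_set_def sum_nonneg)
    also have "\<dots> = (\<Sum>i\<in>UNIV. (norm (d i))\<^sup>2 + 2 * m * (y i \<bullet> d i) + m\<^sup>2 * (norm (y i))\<^sup>2)"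
      unfolding power2_norm_eq_inner
      by (intro sum.cong refl)
        (simp add: inner_add_left inner_add_right inner_commute power2_eq_square algebra_simps)
    also have "\<dots> = D\<^sup>2 + 2 * m * (\<Sum>i\<in>UNIV. y i \<bullet> d i) + m\<^sup>2 * Y\<^sup>2"
      by (simp add: sum.distrib sum_distrib_left D_def Y_def L2_set_def sum_nonneg)
    finally show ?thesis by (simp add: orth power_mult_distrib)
  qed
  have mY: "m * Y \<le> a" by (rule power2_le_imp_le) (use a2 nn in simp_all)
  have Da: "D \<le> a" by (rule power2_le_imp_le) (use a2 nn in simp_all)
  have mYD: "2 * (m * Y * D) \<le> a\<^sup>2"
    using zero_le_power2[of "m * Y - D"] unfolding a2 by (simp add: power2_eq_square algebra_simps)
  have "a \<le> L2_set (\<lambda>i. norm (w i - c *\<^sub>R spin_unit) + 2 * \<gamma> * (m * norm (y i))) UNIV"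
    unfolding a_def c_def
    by (intro L2_set_mono scaled_block_estimates(1) newton near_sqrt) simp_all
  also have "\<dots> \<le> B + L2_set (\<lambda>i. 2 * \<gamma> * (m * norm (y i))) UNIV"
    unfolding B_def by (rule L2_set_triangle_ineq)
  also have "L2_set (\<lambda>i. 2 * \<gamma> * (m * norm (y i))) UNIV = 2 * \<gamma> * (m * Y)"
    using m \<gamma> by (simp add: Y_def L2_set_right_distrib)
  also have "B + 2 * \<gamma> * (m * Y) \<le> B + 2 * \<gamma> * a" using mY \<gamma> by simp
  \<comment> \<open>The estimate gives the factor \<open>1 - 2 \<gamma>\<close>; it is weakened to the factor of the parameter condition.\<close>
  finally have "a * (1 - 3 * \<gamma>) \<le> B" using mult_nonneg_nonneg[OF nn(4), of \<gamma>] \<gamma> by (simp add: algebra_simps)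
  then have "(a * (1 - 3 * \<gamma>))\<^sup>2 \<le> B\<^sup>2" using nn(4) \<gamma> by (intro power_mono) simp_all
  then have "a\<^sup>2 * (1 - 3 * \<gamma>)\<^sup>2 \<le> (\<gamma>\<^sup>2 + \<delta>\<^sup>2) * m\<^sup>2 / 2"
    using B2 by (simp add: power_mult_distrib)
  then have a_\<rho>: "a\<^sup>2 \<le> \<rho> * m\<^sup>2 / 2"
    using \<gamma> by (simp add: \<rho>_def field_simps)
  have \<gamma>_\<rho>: "\<gamma>\<^sup>2 \<le> \<rho>"
  proof -
    have "(1 - 3 * \<gamma>)\<^sup>2 \<le> 1" using \<gamma> by (simp add: power_le_one)
    then have "\<gamma>\<^sup>2 * (1 - 3 * \<gamma>)\<^sup>2 \<le> \<gamma>\<^sup>2" by (simp add: mult_left_le)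
    also have "\<dots> \<le> \<gamma>\<^sup>2 + \<delta>\<^sup>2" by simp
    finally show ?thesis using \<gamma> by (simp add: \<rho>_def field_simps)
  qed
  have \<rho>_small: "4 * \<rho> < \<gamma> * \<nu>" using parameters by (simp add: \<rho>_def)
  have "\<gamma> * \<nu> < \<gamma>" using \<gamma> \<nu> by simp
  \<comment> \<open>The parameter condition together with \<open>\<gamma> < 1 / 3\<close> also controls the absolute size of the step.\<close>
  then have \<rho>_12: "\<rho> < 1 / 12" using \<rho>_small \<gamma> by linarith
  have \<rho>_nn: "0 \<le> \<rho>" by (simp add: \<rho>_def)
  have a_24: "a\<^sup>2 < m\<^sup>2 / 24"
  proof -
    have "\<rho> * m\<^sup>2 < (1 / 12) * m\<^sup>2" using \<rho>_12 m by (intro mult_strict_right_mono) simp_all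
    then show ?thesis using a_\<rho> by linarith
  qed
  have norm_y: "norm (y i) \<le> Y" and norm_d: "norm (d i) \<le> D" for i
    unfolding Y_def D_def
    using member_le_L2_set[of UNIV i "\<lambda>i. norm (y i)"] member_le_L2_set[of UNIV i "\<lambda>i. norm (d i)"]
    by simp_all

  show "in_cone_interior (spin_unit + y i)"
  proof (rule in_cone_interior_near_unit[where r = 1])
    have "m * norm (y i) \<le> a" using norm_y[of i] mY m by (meson mult_left_mono less_imp_le order_trans)
    then have "(m * norm (y i))\<^sup>2 \<le> a\<^sup>2" using m by (intro power_mono) simp_all
    then have "m\<^sup>2 * (norm (y i))\<^sup>2 < m\<^sup>2 * (1 / 24)" using a_24 by (simp add: power_mult_distrib)
    then have "(norm (y i))\<^sup>2 < 1 / 24" using m by (simp only: mult_less_cancel_left_pos zero_less_power)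
    then show "2 * (norm (spin_unit + y i - 1 *\<^sub>R spin_unit))\<^sup>2 < 1\<^sup>2" by simp
  qed simp
  show "in_cone_interior (w i + d i)"
  proof (rule in_cone_interior_near_unit[where r = m])
    \<comment> \<open>The distances are at most \<open>m / \<surd>18\<close> and \<open>m / \<surd>24\<close>, with sum below \<open>m / \<surd>2\<close>.\<close>
    let ?p = "norm (w i - m *\<^sub>R spin_unit)" and ?q = "norm (d i)"
    have "?q\<^sup>2 \<le> a\<^sup>2" using norm_d[of i] Da by (intro power_mono) simp_all
    then have q: "?q\<^sup>2 < m\<^sup>2 / 24" using a_24 by simp
    have "(\<gamma> * m)\<^sup>2 \<le> (1 / 3 * m)\<^sup>2" using \<gamma> m by (intro power_mono mult_right_mono) simp_all
    then have p: "?p\<^sup>2 \<le> m\<^sup>2 / 18" using near_i[of i] by (simp add: power_mult_distrib power_divide)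
    have "norm (w i + d i - m *\<^sub>R spin_unit) \<le> ?p + ?q"
      using norm_triangle_ineq[of "w i - m *\<^sub>R spin_unit" "d i"] by (simp add: algebra_simps)
    then have "(norm (w i + d i - m *\<^sub>R spin_unit))\<^sup>2 \<le> (?p + ?q)\<^sup>2" by (intro power_mono) simp_all
    also have "\<dots> \<le> 2 * ?p\<^sup>2 + 2 * ?q\<^sup>2"
      using zero_le_power2[of "?p - ?q"] by (simp add: power2_eq_square algebra_simps)
    finally show "2 * (norm (w i + d i - m *\<^sub>R spin_unit))\<^sup>2 < m\<^sup>2" using p q zero_less_power[OF m, of 2] by linarith
  qed (fact m)

  \<comment> \<open>The second block estimate with \<open>norm (d i)\<close> replaced by the total norm \<open>D\<close>, so that it can be summed.\<close>
  define h where "h = Y * (\<gamma> * m + sqrt 2 * D)"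
  have h_nn: "0 \<le> h" using nn m \<gamma> by (simp add: h_def)
  have "(\<Sum>i\<in>UNIV. gap c (spin_unit + y i) (w i + d i))
      \<le> (\<Sum>i\<in>UNIV. (norm (y i) * (\<gamma> * m + sqrt 2 * D))\<^sup>2)"
  proof (rule sum_mono)
    fix i
    have "gap c (spin_unit + y i) (w i + d i) \<le> (norm (y i) * (\<gamma> * m + sqrt 2 * norm (d i)))\<^sup>2"
      unfolding c_def by (rule scaled_block_estimates(2)[OF newton near_sqrt])
    also have "\<dots> \<le> (norm (y i) * (\<gamma> * m + sqrt 2 * D))\<^sup>2"
      using norm_d[of i] m \<gamma> by (intro power_mono mult_left_mono add_left_mono) simp_all
    finally show "gap c (spin_unit + y i) (w i + d i) \<le> \<dots>" .
  qed
  also have "\<dots> = h\<^sup>2"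
    by (simp add: h_def Y_def L2_set_def power_mult_distrib sum_distrib_right sum_nonneg)
  finally have gap_h: "(\<Sum>i\<in>UNIV. gap c (spin_unit + y i) (w i + d i)) \<le> h\<^sup>2" .
  have "sqrt 2 * h \<le> \<gamma> * c"
  proof -
    have "sqrt 2 * (\<gamma> * a) \<le> \<rho> * m"
    proof (rule power2_le_imp_le)
      have "2 * (\<gamma>\<^sup>2 * a\<^sup>2) \<le> 2 * (\<rho> * (\<rho> * m\<^sup>2 / 2))"
        using \<gamma>_\<rho> a_\<rho> \<rho>_nn by (intro mult_left_mono mult_mono) simp_all
      then show "(sqrt 2 * (\<gamma> * a))\<^sup>2 \<le> (\<rho> * m)\<^sup>2"
        by (simp add: power_mult_distrib power2_eq_square mult_ac)
      show "0 \<le> \<rho> * m" using \<rho>_nn m by simp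
    qed
    then have 1: "m * (sqrt 2 * (\<gamma> * a)) \<le> m * (\<rho> * m)" using m by (intro mult_left_mono) simp_all
    have "m * (sqrt 2 * h) = sqrt 2 * (\<gamma> * m) * (m * Y) + 2 * (m * Y * D)"
      by (simp add: h_def algebra_simps)
    also have "\<dots> \<le> sqrt 2 * (\<gamma> * m) * a + a\<^sup>2"
      using mY mYD m \<gamma> by (intro add_mono mult_left_mono) simp_all
    also have "\<dots> \<le> m * (\<rho> * m) + \<rho> * m\<^sup>2 / 2" using 1 a_\<rho> by (simp add: mult_ac)
    also have "\<dots> \<le> m * (4 * \<rho> * m)" using \<rho>_nn by (simp add: power2_eq_square mult_ac)
    finally have "sqrt 2 * h \<le> 4 * \<rho> * m" using m by (simp only: mult_le_cancel_left_pos)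
    also have "\<dots> \<le> \<gamma> * \<nu> * m" using \<rho>_small m by (intro mult_right_mono) simp_all
    finally show ?thesis by (simp add: c_def mult_ac)
  qed
  then have "(sqrt 2 * h)\<^sup>2 \<le> (\<gamma> * c)\<^sup>2" using h_nn by (intro power_mono) simp_all
  then have "h\<^sup>2 \<le> \<gamma>\<^sup>2 * c\<^sup>2 / 2" by (simp add: power_mult_distrib)
  with gap_h show "(\<Sum>i\<in>UNIV. gap (\<nu> * m) (spin_unit + y i) (w i + d i)) \<le> \<gamma>\<^sup>2 * (\<nu> * m)\<^sup>2 / 2"
    by (simp add: c_def)
qed

text \<open>
  This is applied in the frame of the scaling matrix, where the Newton equation is exact.
\<close>

lemma defect_nonpos_if_symmetric:
  fixes x t y s :: "real \<times> 'v::euclidean_space"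
  assumes "jprod x t + jprod y s = c *\<^sub>R spin_unit"
  shows "defect c x t y s \<le> 0"
  using wedge_sum_nonneg[of "snd x" "snd t" "snd y" "snd s"]
  by (simp add: defect_eq_symmetric_minus_wedge assms algebra_simps)

text \<open>
  The frame of \<open>T\<^sub>x\<close> reduces the general case to \<open>scaled_short_step\<close>. Every hypothesis is expressed by
  frame-independent quantities, and the conclusions return to the original frame: the gap by invariance,
  interiority through the signs of Lorentz products.
\<close>

lemma short_step:
  fixes x s dx ds :: "'i::finite \<Rightarrow> real \<times> 'v::euclidean_space"
  assumes m: "0 < m" and \<gamma>: "0 < \<gamma>" "\<gamma> < 1 / 3" and \<nu>: "0 < \<nu>" "\<nu> < 1"
    and \<nu>_\<delta>: "(1 - \<nu>)\<^sup>2 * real CARD('i) = \<delta>\<^sup>2 / 2"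
    and parameters: "4 * (\<gamma>\<^sup>2 + \<delta>\<^sup>2) / (1 - 3 * \<gamma>)\<^sup>2 < \<gamma> * \<nu>"
    and x: "\<And>i. in_cone_interior (x i)" and s: "\<And>i. in_cone_interior (s i)"
    and trace: "(\<Sum>i\<in>UNIV. x i \<bullet> s i) = real CARD('i) * m"
    and near: "(\<Sum>i\<in>UNIV. gap m (x i) (s i)) \<le> \<gamma>\<^sup>2 * m\<^sup>2 / 2"
    and newton: "\<And>i. defect (\<nu> * m) (x i) (s i + ds i) (dx i) (s i) \<le> 0"
    and orth: "(\<Sum>i\<in>UNIV. dx i \<bullet> ds i) = 0"
  shows "(\<Sum>i\<in>UNIV. gap (\<nu> * m) (x i + dx i) (s i + ds i)) \<le> \<gamma>\<^sup>2 * (\<nu> * m)\<^sup>2 / 2"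
    and "in_cone_interior (x i + dx i)" and "in_cone_interior (s i + ds i)"
proof -
  define w where "w i = spin_T (x i) (s i)" for i
  define d where "d i = spin_T (x i) (ds i)" for i
  define y where "y i = spin_T_inv (x i) (dx i)" for i
  have trace': "(\<Sum>i\<in>UNIV. fst (w i)) = real CARD('i) * m"
    using trace by (simp add: w_def spin_T_def Let_def)
  have near': "(\<Sum>i\<in>UNIV. (norm (w i - m *\<^sub>R spin_unit))\<^sup>2) \<le> \<gamma>\<^sup>2 * m\<^sup>2 / 2"
    using near by (simp add: w_def gap_spin_T[OF x])
  have newton': "defect (\<nu> * m) spin_unit (w i + d i) (y i) (w i) \<le> 0" for i
    using newton[of i] defect_spin_T[OF x[of i], of "\<nu> * m" "x i" "s i + ds i" "dx i" "s i"]
    by (simp add: w_def d_def y_def spin_T_inv_self[OF x] spin_T_add)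
  have orth': "(\<Sum>i\<in>UNIV. y i \<bullet> d i) = 0"
    using orth by (simp add: y_def d_def spin_T_inv_inner[OF x])
  note scaled = scaled_short_step[OF m \<gamma> \<nu> \<nu>_\<delta> parameters trace' near' newton' orth']
  have y_eq: "spin_unit + y i = spin_T_inv (x i) (x i + dx i)" for i
    by (simp add: y_def spin_T_inv_add spin_T_inv_self[OF x])
  have w_eq: "w i + d i = spin_T (x i) (s i + ds i)" for i
    by (simp add: w_def d_def spin_T_add)
  show "(\<Sum>i\<in>UNIV. gap (\<nu> * m) (x i + dx i) (s i + ds i)) \<le> \<gamma>\<^sup>2 * (\<nu> * m)\<^sup>2 / 2"
    using scaled(1) unfolding y_eq w_eq gap_spin_T_invariant[OF x] .
  have unit: "in_cone_interior spin_unit" by (simp add: in_cone_interior_def)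
  have det: "0 < lorentz (x i) (x i)" using lorentz_pos[OF x x] .
  show "in_cone_interior (x i + dx i)"
  proof (rule in_cone_interior_if_lorentz_pos[OF x[of i]])
    show "0 < lorentz (x i + dx i) (x i + dx i)"
      using lorentz_pos[OF scaled(2) scaled(2), of i i] det unfolding y_eq lorentz_spin_T_inv[OF x]
      by (simp add: zero_less_mult_iff)
    have "0 < lorentz (spin_T_inv (x i) (x i)) (spin_T_inv (x i) (x i + dx i))"
      using lorentz_pos[OF unit scaled(2), of i] by (simp only: y_eq spin_T_inv_self[OF x])
    then show "0 < lorentz (x i) (x i + dx i)"
      using det unfolding lorentz_spin_T_inv[OF x] by (simp add: zero_less_mult_iff)
  qed
  have w_cone: "in_cone_interior (w i)"
  proof (rule in_cone_interior_near_unit[OF _ m])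
    have "(norm (w i - m *\<^sub>R spin_unit))\<^sup>2 \<le> (\<Sum>i\<in>UNIV. (norm (w i - m *\<^sub>R spin_unit))\<^sup>2)"
      by (rule member_le_sum) simp_all
    moreover have "\<gamma>\<^sup>2 * m\<^sup>2 < 1 * m\<^sup>2"
      using \<gamma> m by (intro mult_strict_right_mono) (simp_all add: power_less_one_iff abs_square_less_1)
    ultimately show "2 * (norm (w i - m *\<^sub>R spin_unit))\<^sup>2 < m\<^sup>2" using near' by linarith
  qed
  show "in_cone_interior (s i + ds i)"
  proof (rule in_cone_interior_if_lorentz_pos[OF s[of i]])
    show "0 < lorentz (s i + ds i) (s i + ds i)"
      using lorentz_pos[OF scaled(3) scaled(3), of i i] det unfolding w_eq lorentz_spin_T[OF x]
      by (simp add: zero_less_mult_iff)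
    show "0 < lorentz (s i) (s i + ds i)"
      using lorentz_pos[OF w_cone scaled(3), of i] det unfolding w_eq unfolding w_def lorentz_spin_T[OF x]
      by (simp add: zero_less_mult_iff)
  qed
qed

section \<open>Second-order cones as blocks of coordinates\<close>

locale cone_blocks =
  fixes blk :: "'n::finite \<Rightarrow> 'k::finite" and lead :: "'k \<Rightarrow> 'n"
  assumes lead: "\<And>i. blk (lead i) = i"
begin

text \<open>
  A block is placed in the same space \<open>\<real> \<times> \<real>\<^sup>n\<close> whatever its size, with zeros outside its tail, so that
  blocks of different dimensions can be treated uniformly; a one-dimensional block has zero tail.
\<close>

definition block :: "'k \<Rightarrow> real^'n \<Rightarrow> real \<times> (real^'n)" where
  "block i v = (v $ lead i, \<chi> j. if j \<in> tail_ix blk lead i then v $ j else 0)"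

lemma block_add: "block i (u + v) = block i u + block i v"
  and block_diff: "block i (u - v) = block i u - block i v"
  and block_scaleR: "block i (r *\<^sub>R v) = r *\<^sub>R block i v"
  by (simp_all add: block_def vec_eq_iff)

lemma block_indices: "{j. blk j = i} = insert (lead i) (tail_ix blk lead i)"
  using lead by (auto simp: tail_ix_def)

lemma sum_block:
  "(\<Sum>j | blk j = i. f j) = f (lead i) + (\<Sum>j\<in>tail_ix blk lead i. f j)"
  for f :: "'n \<Rightarrow> 'a::comm_monoid_add"
  unfolding block_indices by (simp add: tail_ix_def)

lemma inner_snd_block:
  "snd (block i u) \<bullet> snd (block i v) = (\<Sum>j\<in>tail_ix blk lead i. u $ j * v $ j)"
proof -
  have "snd (block i u) \<bullet> snd (block i v)
      = (\<Sum>j\<in>UNIV. if j \<in> tail_ix blk lead i then u $ j * v $ j else 0)"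
    by (auto simp: block_def inner_vec_def intro!: sum.cong)
  then show ?thesis by (simp add: sum.If_cases)
qed

lemma inner_block:
  "block i u \<bullet> block i v = (\<Sum>j | blk j = i. u $ j * v $ j)"
  unfolding inner_prod_def inner_snd_block sum_block by (simp add: block_def)

lemma sum_inner_block:
  "(\<Sum>i\<in>UNIV. block i u \<bullet> block i v) = u \<bullet> v"
  unfolding inner_block inner_vec_def
  using sum.group[of UNIV UNIV blk "\<lambda>j. u $ j * v $ j"] by simp

lemma sum_norm_block: "(\<Sum>i\<in>UNIV. (norm (block i u))\<^sup>2) = (norm u)\<^sup>2"
  unfolding power2_norm_eq_inner by (rule sum_inner_block)

lemma norm_snd_block: "norm (snd (block i v)) = tail_norm blk lead v i"
  unfolding norm_eq_sqrt_inner inner_snd_block tail_norm_def L2_set_def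
  by (simp add: power2_eq_square)

lemma block_jordan_unit: "block i (jordan_unit blk lead) = spin_unit"
  using lead by (auto simp: block_def jordan_unit_def tail_ix_def vec_eq_iff)

lemma interior_soc_product:
  "interior (soc_product blk lead) = {v. \<forall>i. in_cone_interior (block i v)}"
proof -
  let ?U = "{v. \<forall>i. tail_norm blk lead v i < v $ lead i}"
  have "interior (soc_product blk lead) = ?U"
  proof (rule interior_unique)
    show "?U \<subseteq> soc_product blk lead" by (auto simp: soc_product_def less_imp_le)
    have "open (\<Inter>i\<in>UNIV. {v. tail_norm blk lead v i < v $ lead i})"
      unfolding tail_norm_def L2_set_def
      by (intro open_INT finite ballI open_Collect_less continuous_intros)
    then show "open ?U" by (simp add: Collect_all_eq)
    fix T assume T: "T \<subseteq> soc_product blk lead" "open T"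
    show "T \<subseteq> ?U"
    proof
      fix v assume "v \<in> T"
      then obtain r where r: "0 < r" "ball v r \<subseteq> T" using T(2) open_contains_ball by blast
      let ?e = "jordan_unit blk lead"
      \<comment> \<open>Moving from \<open>v\<close> a little against \<open>e\<close> stays in the cone and lowers the leading entries only.\<close>
      define h where "h = r / 2 / (1 + norm ?e)"
      have h: "0 < h" using r by (simp add: h_def add_pos_nonneg)
      have "h * norm ?e \<le> h * (1 + norm ?e)" using h by (simp add: mult_left_mono)
      also have "\<dots> = r / 2"
      proof -
        have "1 + norm ?e \<noteq> 0" using norm_ge_zero[of ?e] by linarith
        from iffD1[OF nonzero_eq_divide_eq[OF this] h_def] show ?thesis .
      qed
      finally have "v - h *\<^sub>R ?e \<in> ball v r" using r h by (simp add: dist_norm)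
      then have K: "v - h *\<^sub>R ?e \<in> soc_product blk lead" using r T by blast
      have "tail_norm blk lead v i < v $ lead i" for i
      proof -
        have "tail_norm blk lead (v - h *\<^sub>R ?e) i = tail_norm blk lead v i"
          unfolding tail_norm_def using lead
          by (intro L2_set_cong) (auto simp: tail_ix_def jordan_unit_def)
        moreover have "(v - h *\<^sub>R ?e) $ lead i = v $ lead i - h"
          using lead by (simp add: jordan_unit_def)
        moreover have "tail_norm blk lead (v - h *\<^sub>R ?e) i \<le> (v - h *\<^sub>R ?e) $ lead i"
          using K by (simp add: soc_product_def)
        ultimately show ?thesis using h by simp
      qed
      then show "v \<in> ?U" by simp
    qed
  qed
  then show ?thesis by (simp add: in_cone_interior_def norm_snd_block) (simp add: block_def)
qed

lemma blkdiag_mult_vec: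
  "(blkdiag blk B *v v) $ a = (\<Sum>b | blk b = blk a. B (blk a) a b * v $ b)"
proof -
  have "(blkdiag blk B *v v) $ a = (\<Sum>b\<in>UNIV. if b \<in> {b. blk b = blk a} then B (blk a) a b * v $ b else 0)"
    by (auto simp: blkdiag_def matrix_vector_mult_def intro!: sum.cong)
  then show ?thesis by (simp only: sum.If_cases finite) simp
qed

lemma block_jordan_mat:
  "block i (jordan_mat blk lead u *v v)
     = jprod (block i u) (block i v)"
proof -
  have head: "(jordan_mat blk lead u *v v) $ lead i = block i u \<bullet> block i v"
    unfolding jordan_mat_def blkdiag_mult_vec inner_block by (simp add: lead)
  have tail: "(jordan_mat blk lead u *v v) $ j = u $ lead i * v $ j + v $ lead i * u $ j"
    if "j \<in> tail_ix blk lead i" for j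
  proof -
    have j: "blk j = i" "j \<noteq> lead i" using that by (auto simp: tail_ix_def)
    have "(\<Sum>b\<in>tail_ix blk lead i. (if b = lead i then u $ j else if j = b then u $ lead i else 0) * v $ b)
        = (\<Sum>b\<in>tail_ix blk lead i. if b = j then u $ lead i * v $ b else 0)"
      by (rule sum.cong[OF refl]) (auto simp: tail_ix_def)
    then show ?thesis
      unfolding jordan_mat_def blkdiag_mult_vec j(1) sum_block using j(2) that by simp
  qed
  show ?thesis
    using head tail by (simp add: jprod_def block_def[of _ "jordan_mat blk lead u *v v"] vec_eq_iff)
      (simp add: block_def)
qed

lemma block_T_mat:
  "block i (T_mat blk lead u *v v) = spin_T (block i u) (block i v)"
proof -
  define \<beta> where "\<beta> = soc_beta blk lead u i"
  have \<beta>: "\<beta> = sqrt (lorentz (block i u) (block i u))"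
    unfolding \<beta>_def soc_beta_def lorentz_def norm_snd_block[symmetric] power2_norm_eq_inner
    by (simp add: power2_eq_square) (simp add: block_def)
  define p where "p = (\<Sum>b\<in>tail_ix blk lead i. u $ b * v $ b)"
  have head: "(T_mat blk lead u *v v) $ lead i = block i u \<bullet> block i v"
    unfolding T_mat_def blkdiag_mult_vec inner_block by (simp add: lead)
  have tail: "(T_mat blk lead u *v v) $ j = v $ lead i * u $ j + \<beta> * v $ j + p / (\<beta> + u $ lead i) * u $ j"
    if "j \<in> tail_ix blk lead i" for j
  proof -
    have j: "blk j = i" "j \<noteq> lead i" using that by (auto simp: tail_ix_def)
    define k where "k = u $ j / (\<beta> + u $ lead i)"
    have "(\<Sum>b\<in>tail_ix blk lead i. (if b = lead i then u $ j
            else (if j = b then \<beta> else 0) + u $ j * u $ b / (\<beta> + u $ lead i)) * v $ b)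
        = (\<Sum>b\<in>tail_ix blk lead i. (if b = j then \<beta> * v $ b else 0) + (u $ b * v $ b) * k)"
      by (rule sum.cong[OF refl]) (auto simp: tail_ix_def k_def algebra_simps)
    also have "\<dots> = \<beta> * v $ j + p * k"
      using that by (simp add: sum.distrib p_def sum_distrib_right[symmetric])
    also have "p * k = p / (\<beta> + u $ lead i) * u $ j" by (simp add: k_def)
    finally show ?thesis
      unfolding T_mat_def blkdiag_mult_vec j(1) sum_block \<beta>_def using j(2) by simp
  qed
  have p: "snd (block i u) \<bullet> snd (block i v) = p"
    by (simp add: inner_snd_block p_def)
  show ?thesis
    unfolding spin_T_def Let_def \<beta>[symmetric] p
    using head tail by (simp add: block_def[of _ "T_mat blk lead u *v v"] vec_eq_iff)
      (simp add: block_def)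
qed

lemma lorentz_block:
  "lorentz (block i u) (block i v)
     = (\<Sum>r | blk r = i. \<Sum>q | blk q = i. u $ r * Q_entry lead i r q * v $ q)"
proof -
  have "(\<Sum>q | blk q = i. u $ r * Q_entry lead i r q * v $ q)
      = (if r = lead i then 1 else -1) * (u $ r * v $ r)" if "blk r = i" for r
  proof -
    have "(\<Sum>q | blk q = i. u $ r * Q_entry lead i r q * v $ q)
        = (\<Sum>q | blk q = i. if q = r then (if r = lead i then 1 else -1) * (u $ r * v $ r) else 0)"
      by (rule sum.cong[OF refl]) (auto simp: Q_entry_def)
    then show ?thesis using that by simp
  qed
  then have "(\<Sum>r | blk r = i. \<Sum>q | blk q = i. u $ r * Q_entry lead i r q * v $ q)
      = (\<Sum>r | blk r = i. (if r = lead i then 1 else -1) * (u $ r * v $ r))"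
    by simp
  also have "\<dots> = u $ lead i * v $ lead i - (\<Sum>j\<in>tail_ix blk lead i. u $ j * v $ j)"
    unfolding sum_block
    by (simp add: sum_negf[symmetric]) (auto simp: tail_ix_def intro!: sum.cong)
  finally show ?thesis by (simp add: lorentz_def inner_snd_block) (simp add: block_def)
qed

lemma scaling_matrix_lorentz:
  assumes "D \<in> scaling_matrices blk lead"
  obtains \<theta> where "\<And>i. 0 < \<theta> i"
    and "\<And>i u v. lorentz (block i (D *v u)) (block i (D *v v))
           = (\<theta> i)\<^sup>2 * lorentz (block i u) (block i v)"
proof -
  from assms obtain \<theta> :: "'k \<Rightarrow> real" and G where
    D: "D = blkdiag blk (\<lambda>i a b. \<theta> i * G i a b)" and pos: "\<And>i. 0 < \<theta> i"
    and G: "\<And>i a b. blk a = i \<Longrightarrow> blk b = i \<Longrightarrow>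
          (\<Sum>r | blk r = i. \<Sum>q | blk q = i. G i r a * Q_entry lead i r q * G i q b)
            = Q_entry lead i a b"
    unfolding scaling_matrices_def by blast
  have "lorentz (block i (D *v u)) (block i (D *v v))
           = (\<theta> i)\<^sup>2 * lorentz (block i u) (block i v)" for i u v
  proof -
    let ?I = "{j. blk j = i}"
    have Dv: "(D *v z) $ r = \<theta> i * (\<Sum>a\<in>?I. G i r a * z $ a)" if "r \<in> ?I" for r z
      using that unfolding D blkdiag_mult_vec by (simp add: sum_distrib_left mult.assoc)
    have "lorentz (block i (D *v u)) (block i (D *v v))
        = (\<Sum>r\<in>?I. \<Sum>q\<in>?I. (\<theta> i * (\<Sum>a\<in>?I. G i r a * u $ a)) * Q_entry lead i r q
             * (\<theta> i * (\<Sum>b\<in>?I. G i q b * v $ b)))"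
      unfolding lorentz_block by (intro sum.cong refl) (simp only: Dv)
    also have "\<dots> = (\<Sum>r\<in>?I. \<Sum>q\<in>?I. \<Sum>a\<in>?I. \<Sum>b\<in>?I.
        (\<theta> i)\<^sup>2 * (u $ a * (G i r a * Q_entry lead i r q * G i q b) * v $ b))"
      by (simp add: sum_distrib_left sum_distrib_right power2_eq_square mult_ac)
    also have "\<dots> = (\<Sum>a\<in>?I. \<Sum>r\<in>?I. \<Sum>q\<in>?I. \<Sum>b\<in>?I.
        (\<theta> i)\<^sup>2 * (u $ a * (G i r a * Q_entry lead i r q * G i q b) * v $ b))"
      by (subst (2) sum.swap, subst (1) sum.swap) (rule refl)
    also have "\<dots> = (\<Sum>a\<in>?I. \<Sum>b\<in>?I. \<Sum>r\<in>?I. \<Sum>q\<in>?I.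
        (\<theta> i)\<^sup>2 * (u $ a * (G i r a * Q_entry lead i r q * G i q b) * v $ b))"
      by (subst (3) sum.swap, subst (2) sum.swap) (rule refl)
    also have "\<dots> = (\<Sum>a\<in>?I. \<Sum>b\<in>?I. (\<theta> i)\<^sup>2 * (u $ a *
        (\<Sum>r\<in>?I. \<Sum>q\<in>?I. G i r a * Q_entry lead i r q * G i q b) * v $ b))"
      by (simp only: sum_distrib_left sum_distrib_right)
    also have "\<dots> = (\<Sum>a\<in>?I. \<Sum>b\<in>?I. (\<theta> i)\<^sup>2 * (u $ a * Q_entry lead i a b * v $ b))"
      by (intro sum.cong refl) (simp only: G mem_Collect_eq)
    also have "\<dots> = (\<theta> i)\<^sup>2 * lorentz (block i u) (block i v)"
      by (simp only: lorentz_block sum_distrib_left)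
    finally show ?thesis .
  qed
  with pos that show thesis by blast
qed

text \<open>
  With the block reflection \<open>R\<close>, the identity $D^T R D = \theta^2 R$ yields $D^{-T} = \theta^{-2} R D R$, where
  \<open>\<theta>\<close> acts by a scalar on each block. So $D^{-T}$ scales Lorentz forms by the inverse of the factor of \<open>D\<close>.
  Only pairings are carried over to the frame of $D$, and not interiority, since $D$ may exchange a cone
  with its negative.
\<close>

lemma scaling_matrix_pairings:
  assumes "D \<in> scaling_matrices blk lead"
  shows "block i (transpose (matrix_inv D) *v u) \<bullet> block i (D *v v)
           = block i u \<bullet> block i v" (is ?inner)
    and "lorentz (block i (transpose (matrix_inv D) *v u))
             (block i (transpose (matrix_inv D) *v u'))
           * lorentz (block i (D *v v)) (block i (D *v v'))
         = lorentz (block i u) (block i u')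
           * lorentz (block i v) (block i v')" (is ?lorentz)
proof -
  obtain \<theta> where \<theta>: "\<And>i. 0 < \<theta> i" and D: "\<And>i u v. lorentz (block i (D *v u)) (block i (D *v v))
           = (\<theta> i)\<^sup>2 * lorentz (block i u) (block i v)"
    using scaling_matrix_lorentz[OF assms] by blast
  define reflect :: "real^'n \<Rightarrow> real^'n"
    where "reflect v = (\<chi> j. if j = lead (blk j) then v $ j else - v $ j)" for v
  \<comment> \<open>The explicit form of the inverse transpose, verified through its pairing with \<open>D\<close>.\<close>
  define E :: "real^'n \<Rightarrow> real^'n"
    where "E v = (\<chi> j. inverse ((\<theta> (blk j))\<^sup>2) * reflect (D *v reflect v) $ j)" for v
  have block_reflect: "block i (reflect v) = (fst (block i v), - snd (block i v))" for i v
    by (auto simp: block_def reflect_def tail_ix_def vec_eq_iff lead)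
  have block_E: "block i (E v) = inverse ((\<theta> i)\<^sup>2) *\<^sub>R block i (reflect (D *v reflect v))" for i v
    by (auto simp: block_def E_def tail_ix_def vec_eq_iff lead)
  have inner_E: "block i (E u) \<bullet> block i (D *v v) = block i u \<bullet> block i v" for i u v
  proof -
    have "block i (E u) \<bullet> block i (D *v v)
        = inverse ((\<theta> i)\<^sup>2) * lorentz (block i (D *v reflect u)) (block i (D *v v))"
      by (simp add: block_E block_reflect lorentz_def inner_prod_def algebra_simps)
    also have "\<dots> = lorentz (block i (reflect u)) (block i v)"
      using \<theta>[of i] by (simp add: D)
    finally show ?thesis by (simp add: block_reflect lorentz_def inner_prod_def)
  qed
  have lorentz_E: "lorentz (block i (E u)) (block i (E v))
      = inverse ((\<theta> i)\<^sup>2) * lorentz (block i u) (block i v)" for i u v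
  proof -
    have "lorentz (block i (E u)) (block i (E v)) = (inverse ((\<theta> i)\<^sup>2))\<^sup>2
        * lorentz (block i (D *v reflect u)) (block i (D *v reflect v))"
      by (simp add: block_E block_reflect[of _ "D *v _"] lorentz_def power2_eq_square algebra_simps)
    also have "\<dots> = inverse ((\<theta> i)\<^sup>2) * lorentz (block i (reflect u)) (block i (reflect v))"
    proof -
      have "(inverse z)\<^sup>2 * (z * l) = inverse z * l" if "z \<noteq> 0" for z l :: real
        using that by (simp add: power2_eq_square field_simps)
      then show ?thesis using \<theta>[of i] unfolding D by simp
    qed
    finally show ?thesis by (simp add: block_reflect lorentz_def)
  qed
  have E_D: "E u \<bullet> (D *v v) = u \<bullet> v" for u v
    unfolding sum_inner_block[symmetric] inner_E ..
  have "inj ((*v) D)"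
  proof (rule injI)
    fix v v' assume "D *v v = D *v v'"
    then have "u \<bullet> v = u \<bullet> v'" for u by (metis E_D)
    then show "v = v'" by (metis vector_eq_ldot)
  qed
  then have "invertible D"
    using matrix_left_invertible_injective[of D] invertible_left_inverse[of D] by blast
  then have "D ** matrix_inv D = mat 1"
    unfolding invertible_def matrix_inv_def by (rule someI_ex[THEN conjunct1])
  then have "transpose (matrix_inv D) ** transpose D = mat 1"
    by (simp add: matrix_transpose_mul[symmetric] transpose_mat)
  moreover have "transpose D *v E u = u" for u
  proof -
    have "(transpose D *v E u) \<bullet> v = u \<bullet> v" for v
      using E_D[of u v] by (simp add: dot_lmul_matrix)
    then show ?thesis by (metis vector_eq_rdot)
  qed
  ultimately have inv: "transpose (matrix_inv D) *v u = E u" for u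
    by (metis matrix_vector_mul_assoc matrix_vector_mul_lid)
  show ?inner unfolding inv by (rule inner_E)
  show ?lorentz unfolding inv lorentz_E D using \<theta>[of i] by simp
qed

end

section \<open>The neighbourhood and the search direction\<close>

lemma sum_option_UNIV:
  "(\<Sum>i\<in>UNIV. f i) = f None + (\<Sum>i\<in>UNIV. f (Some i))" for f :: "'k::finite option \<Rightarrow> real"
  by (simp add: UNIV_option_conv sum.reindex)

lemma card_option_UNIV: "real CARD('k::finite option) = real CARD('k) + 1"
  by (simp add: UNIV_option_conv card_image)

text \<open>
  The system relating \<open>(y, x, \<tau>)\<close> to \<open>(0, s, \<kappa>)\<close> is given by a skew-symmetric matrix.
\<close>

lemma homogeneous_residual_orthogonality:
  fixes A :: "real^'n::finite^'p::finite"
  assumes "A *v x = \<tau> *\<^sub>R b" and "s = \<tau> *\<^sub>R c - transpose A *v y" and "\<kappa> = b \<bullet> y - c \<bullet> x"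
  shows "x \<bullet> s + \<kappa> * \<tau> = 0"
proof -
  have "x \<bullet> (transpose A *v y) = (A *v x) \<bullet> y"
    using dot_lmul_matrix[of y A x] by (simp add: inner_commute)
  also have "\<dots> = \<tau> * (b \<bullet> y)" by (simp add: assms(1))
  finally have adjoint: "x \<bullet> (transpose A *v y) = \<tau> * (b \<bullet> y)" .
  have "x \<bullet> s = \<tau> * (c \<bullet> x) - \<tau> * (b \<bullet> y)"
    unfolding assms(2) inner_diff_right adjoint by (simp add: inner_commute)
  then show ?thesis by (simp add: assms(3) algebra_simps)
qed

context cone_blocks
begin

text \<open>
  The scalar \<open>\<kappa>\<close> or \<open>\<tau>\<close> joins the blocks as a one-dimensional block with index \<open>None\<close>.
\<close>

definition blocks_with_scalar :: "real^'n \<Rightarrow> real \<Rightarrow> 'k option \<Rightarrow> real \<times> (real^'n)" where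
  "blocks_with_scalar x r = case_option (r, 0) (\<lambda>i. block i x)"

lemma blocks_with_scalar_add:
  "blocks_with_scalar (x + x') (r + r') i = blocks_with_scalar x r i + blocks_with_scalar x' r' i"
  by (simp add: blocks_with_scalar_def block_add split: option.split)

lemma sum_inner_blocks_with_scalar:
  shows "(\<Sum>i\<in>UNIV. blocks_with_scalar x r i \<bullet> blocks_with_scalar s r' i)
    = x \<bullet> s + r * r'"
  by (simp add: sum_option_UNIV blocks_with_scalar_def sum_inner_block)

lemma mu_eq_mean_inner:
  shows "(\<Sum>i\<in>UNIV. blocks_with_scalar x \<kappa> i \<bullet> blocks_with_scalar s \<tau> i)
    = real CARD('k option) * mu CARD('k) x s \<kappa> \<tau>"
  unfolding sum_inner_blocks_with_scalar card_option_UNIV mu_def by simp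

lemma d2_eq_sum_gap:
  assumes x: "\<And>i. in_cone_interior (block i x)"
  shows "(d2 blk lead x s \<kappa> \<tau>)\<^sup>2 = 2 * (\<Sum>i\<in>UNIV. gap (mu CARD('k) x s \<kappa> \<tau>)
    (blocks_with_scalar x \<kappa> i) (blocks_with_scalar s \<tau> i))"
proof -
  define m where "m = mu CARD('k) x s \<kappa> \<tau>"
  let ?r = "T_mat blk lead x *v s - m *\<^sub>R jordan_unit blk lead"
  have "(d2 blk lead x s \<kappa> \<tau>)\<^sup>2 = 2 * ((norm ?r)\<^sup>2 + (\<kappa> * \<tau> - m)\<^sup>2)"
    by (simp add: d2_def m_def[symmetric] w_vec_def power_mult_distrib norm_prod_def)
  also have "(norm ?r)\<^sup>2 = (\<Sum>i\<in>UNIV. gap m (block i x) (block i s))"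
    unfolding sum_norm_block[symmetric] block_diff block_scaleR block_jordan_unit
      block_T_mat gap_spin_T[OF x] ..
  also have "(\<kappa> * \<tau> - m)\<^sup>2 = gap m (\<kappa>, 0 :: real^'n) (\<tau>, 0)"
    by (simp add: gap_def lorentz_def power2_eq_square algebra_simps)
  finally show ?thesis
    unfolding m_def[symmetric] by (simp add: sum_option_UNIV blocks_with_scalar_def)
qed

lemma N2_iff_gap:
  assumes \<gamma>: "0 \<le> \<gamma>"
  defines "m \<equiv> mu CARD('k)"
  shows "(x, y, s, \<kappa>, \<tau>) \<in> N2 blk lead \<gamma> \<longleftrightarrow>
    (\<forall>i. in_cone_interior (blocks_with_scalar x \<kappa> i)) \<and>
    (\<forall>i. in_cone_interior (blocks_with_scalar s \<tau> i)) \<and>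
    (\<Sum>i\<in>UNIV. gap (m x s \<kappa> \<tau>) (blocks_with_scalar x \<kappa> i)
        (blocks_with_scalar s \<tau> i)) \<le> \<gamma>\<^sup>2 * (m x s \<kappa> \<tau>)\<^sup>2 / 2"
    (is "_ \<longleftrightarrow> ?X \<and> ?S \<and> ?G")
proof -
  have cone: "(\<forall>i. in_cone_interior (blocks_with_scalar v r i))
      \<longleftrightarrow> v \<in> interior (soc_product blk lead) \<and> 0 < r" for v r
    unfolding interior_soc_product split_option_all blocks_with_scalar_def
    by (auto simp: in_cone_interior_def)
  have "d2 blk lead x s \<kappa> \<tau> \<le> \<gamma> * m x s \<kappa> \<tau> \<longleftrightarrow> ?G" if X: ?X and S: ?S
  proof -
    have "0 < (\<Sum>i\<in>UNIV. blocks_with_scalar x \<kappa> i \<bullet> blocks_with_scalar s \<tau> i)"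
      using X S by (intro sum_pos inner_pos) auto
    then have m: "0 < m x s \<kappa> \<tau>"
      unfolding mu_eq_mean_inner m_def by (simp add: zero_less_mult_iff)
    have x: "in_cone_interior (block i x)" for i
      using X[THEN spec, of "Some i"] by (simp add: blocks_with_scalar_def)
    have "0 \<le> d2 blk lead x s \<kappa> \<tau>" by (simp add: d2_def)
    then have "d2 blk lead x s \<kappa> \<tau> \<le> \<gamma> * m x s \<kappa> \<tau>
        \<longleftrightarrow> (d2 blk lead x s \<kappa> \<tau>)\<^sup>2 \<le> (\<gamma> * m x s \<kappa> \<tau>)\<^sup>2"
      using m \<gamma> by (simp add: abs_le_square_iff[symmetric])
    then show ?thesis
      unfolding d2_eq_sum_gap[OF x] m_def by (simp add: power_mult_distrib field_simps)
  qed
  then show ?thesis unfolding N2_def cone m_def by auto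
qed

text \<open>
  Adding \<open>1 - \<nu>\<close> times the current point to the direction gives a solution of the homogeneous system of
  residuals, whose primal and dual parts are orthogonal by skew-symmetry. By the trace of the Newton
  equation the mixed products of point and direction sum to \<open>- (1 - \<nu>)\<close> times \<open>x \<bullet> s + \<kappa> \<tau>\<close>, which
  cancels the contribution of the point itself, so \<open>(dx, d\<kappa>)\<close> and \<open>(ds, d\<tau>)\<close> are orthogonal.
\<close>

lemma iteration:
  fixes A :: "real^'n^'p::finite"
  assumes \<gamma>: "0 < \<gamma>" "\<gamma> < 1 / 3" and \<nu>: "0 < \<nu>" "\<nu> < 1"
    and \<nu>_\<delta>: "(1 - \<nu>)\<^sup>2 * (real CARD('k) + 1) = \<delta>\<^sup>2 / 2"
    and parameters: "4 * (\<gamma>\<^sup>2 + \<delta>\<^sup>2) / (1 - 3 * \<gamma>)\<^sup>2 < \<gamma> * \<nu>"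
    and D: "D \<in> scaling_matrices blk lead"
    and N2: "(x, y, s, \<kappa>, \<tau>) \<in> N2 blk lead \<gamma>"
    and dir: "search_direction blk lead A b c \<nu> D (x, y, s, \<kappa>, \<tau>) (dx, dy, ds, d\<kappa>, d\<tau>)"
  shows "(x + dx, y + dy, s + ds, \<kappa> + d\<kappa>, \<tau> + d\<tau>) \<in> N2 blk lead \<gamma>"
    and "r_p A b (x + dx, y + dy, s + ds, \<kappa> + d\<kappa>, \<tau> + d\<tau>) = \<nu> *\<^sub>R r_p A b (x, y, s, \<kappa>, \<tau>)"
    and "r_d A c (x + dx, y + dy, s + ds, \<kappa> + d\<kappa>, \<tau> + d\<tau>) = \<nu> *\<^sub>R r_d A c (x, y, s, \<kappa>, \<tau>)"
    and "mu CARD('k) (x + dx) (s + ds) (\<kappa> + d\<kappa>) (\<tau> + d\<tau>) = \<nu> * mu CARD('k) x s \<kappa> \<tau>"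
proof -
  define m where "m = mu CARD('k) x s \<kappa> \<tau>"
  define \<eta> where "\<eta> = 1 - \<nu>"
  define E where "E = transpose (matrix_inv D)"
  let ?e = "jordan_unit blk lead" and ?X = "jordan_mat blk lead (E *v x)"
    and ?S = "jordan_mat blk lead (D *v s)"
  have eqs: "A *v dx - d\<tau> *\<^sub>R b = - \<eta> *\<^sub>R (A *v x - \<tau> *\<^sub>R b)"
    "- (transpose A *v dy) + d\<tau> *\<^sub>R c - ds = - \<eta> *\<^sub>R (- (transpose A *v y) + \<tau> *\<^sub>R c - s)"
    "b \<bullet> dy - c \<bullet> dx - d\<kappa> = - \<eta> * (b \<bullet> y - c \<bullet> x - \<kappa>)"
    "?X *v (D *v ds) + ?S *v (E *v dx) = (\<nu> * m) *\<^sub>R ?e - ?X *v (?S *v ?e)"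
    "\<kappa> * d\<tau> + \<tau> * d\<kappa> = \<nu> * m - \<kappa> * \<tau>"
    using dir by (simp_all add: Let_def m_def E_def \<eta>_def)
  have \<nu>\<eta>: "\<nu> = 1 - \<eta>" by (simp add: \<eta>_def)

  show "r_p A b (x + dx, y + dy, s + ds, \<kappa> + d\<kappa>, \<tau> + d\<tau>) = \<nu> *\<^sub>R r_p A b (x, y, s, \<kappa>, \<tau>)"
    using eqs(1) unfolding \<nu>\<eta> by (simp add: matrix_vector_right_distrib algebra_simps)
  show "r_d A c (x + dx, y + dy, s + ds, \<kappa> + d\<kappa>, \<tau> + d\<tau>) = \<nu> *\<^sub>R r_d A c (x, y, s, \<kappa>, \<tau>)"
    using eqs(2) unfolding \<nu>\<eta> by (simp add: matrix_vector_right_distrib algebra_simps)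

  let ?b = "block" and ?x = "blocks_with_scalar x \<kappa>"
    and ?s = "blocks_with_scalar s \<tau>" and ?dx = "blocks_with_scalar dx d\<kappa>"
    and ?ds = "blocks_with_scalar ds d\<tau>"
  have newton_block: "jprod (?b i (E *v x)) (?b i (D *v (s + ds))) + jprod (?b i (E *v dx)) (?b i (D *v s))
      = (\<nu> * m) *\<^sub>R spin_unit" for i
  proof -
    have "jprod (?b i (E *v x)) (?b i (D *v ds)) + jprod (?b i (D *v s)) (?b i (E *v dx))
      = (\<nu> * m) *\<^sub>R spin_unit - jprod (?b i (E *v x)) (jprod (?b i (D *v s)) spin_unit)"
      using arg_cong[OF eqs(4), of "?b i"]
      by (simp only: block_add block_diff block_scaleR block_jordan_unit block_jordan_mat)
    then show ?thesis
      by (simp add: matrix_vector_right_distrib block_add jprod_add_right jprod_commute[of "?b i (D *v s)"]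
          algebra_simps)
  qed
  have newton: "defect (\<nu> * m) (?x i) (?s i + ?ds i) (?dx i) (?s i) \<le> 0
      \<and> ?x i \<bullet> (?s i + ?ds i) + ?dx i \<bullet> ?s i = \<nu> * m" for i
  proof (cases i)
    case None
    have "\<kappa> * (\<tau> + d\<tau>) + d\<kappa> * \<tau> = \<nu> * m" using eqs(5) by (simp add: algebra_simps)
    then have "jprod (?x i) (?s i + ?ds i) + jprod (?dx i) (?s i) = (\<nu> * m) *\<^sub>R spin_unit"
      and "?x i \<bullet> (?s i + ?ds i) + ?dx i \<bullet> ?s i = \<nu> * m"
      by (simp_all add: None blocks_with_scalar_def jprod_def)
    then show ?thesis using defect_nonpos_if_symmetric by blast
  next
    case (Some l)
    note pairings = scaling_matrix_pairings[OF D, folded E_def]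
    have "defect (\<nu> * m) (?b l x) (?b l (s + ds)) (?b l dx) (?b l s)
        = defect (\<nu> * m) (?b l (E *v x)) (?b l (D *v (s + ds))) (?b l (E *v dx)) (?b l (D *v s))"
      by (simp only: defect_def pairings)
    also have "\<dots> \<le> 0" by (rule defect_nonpos_if_symmetric[OF newton_block])
    finally have 1: "defect (\<nu> * m) (?b l x) (?b l (s + ds)) (?b l dx) (?b l s) \<le> 0" .
    have "?b l (E *v x) \<bullet> ?b l (D *v (s + ds)) + ?b l (E *v dx) \<bullet> ?b l (D *v s) = \<nu> * m"
      using arg_cong[OF newton_block[of l], of fst] by (simp add: jprod_def)
    then have "?b l x \<bullet> ?b l (s + ds) + ?b l dx \<bullet> ?b l s = \<nu> * m" by (simp only: pairings)
    with 1 show ?thesis by (simp add: Some blocks_with_scalar_def block_add)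
  qed
  have trace: "(\<Sum>i\<in>UNIV. ?x i \<bullet> ?s i) = real CARD('k option) * m"
    unfolding m_def by (rule mu_eq_mean_inner)
  \<comment> \<open>The first component of the Newton equation, summed over all blocks.\<close>
  have linear: "x \<bullet> (s + ds) + \<kappa> * (\<tau> + d\<tau>) + (dx \<bullet> s + d\<kappa> * \<tau>) = real CARD('k option) * (\<nu> * m)"
  proof -
    have "(\<Sum>i\<in>UNIV. ?x i \<bullet> (?s i + ?ds i) + ?dx i \<bullet> ?s i) = real CARD('k option) * (\<nu> * m)"
      using newton by simp
    then show ?thesis
      by (simp only: sum.distrib blocks_with_scalar_add[symmetric] sum_inner_blocks_with_scalar)
  qed
  have orth: "dx \<bullet> ds + d\<kappa> * d\<tau> = 0"
  proof -
    have zero: "(dx + \<eta> *\<^sub>R x) \<bullet> (ds + \<eta> *\<^sub>R s) + (d\<kappa> + \<eta> * \<kappa>) * (d\<tau> + \<eta> * \<tau>) = 0"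
    proof (rule homogeneous_residual_orthogonality)
      show "A *v (dx + \<eta> *\<^sub>R x) = (d\<tau> + \<eta> * \<tau>) *\<^sub>R b"
        using eqs(1) by (simp add: matrix_vector_right_distrib matrix_vector_mult_scaleR algebra_simps)
      show "ds + \<eta> *\<^sub>R s = (d\<tau> + \<eta> * \<tau>) *\<^sub>R c - transpose A *v (dy + \<eta> *\<^sub>R y)"
        using eqs(2) by (simp add: matrix_vector_right_distrib matrix_vector_mult_scaleR algebra_simps)
      show "d\<kappa> + \<eta> * \<kappa> = b \<bullet> (dy + \<eta> *\<^sub>R y) - c \<bullet> (dx + \<eta> *\<^sub>R x)"
        using eqs(3) by (simp add: inner_add_right algebra_simps)
    qed
    have "(dx + \<eta> *\<^sub>R x) \<bullet> (ds + \<eta> *\<^sub>R s) + (d\<kappa> + \<eta> * \<kappa>) * (d\<tau> + \<eta> * \<tau>)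
      = dx \<bullet> ds + d\<kappa> * d\<tau>
        + \<eta> * ((x \<bullet> (s + ds) + \<kappa> * (\<tau> + d\<tau>) + (dx \<bullet> s + d\<kappa> * \<tau>)) - (x \<bullet> s + \<kappa> * \<tau>))
        + \<eta>\<^sup>2 * (x \<bullet> s + \<kappa> * \<tau>)"
      by (simp add: inner_add_left inner_add_right power2_eq_square algebra_simps)
    also have "x \<bullet> s + \<kappa> * \<tau> = real CARD('k option) * m"
      using trace unfolding sum_inner_blocks_with_scalar .
    finally have "(dx + \<eta> *\<^sub>R x) \<bullet> (ds + \<eta> *\<^sub>R s) + (d\<kappa> + \<eta> * \<kappa>) * (d\<tau> + \<eta> * \<tau>)
      = dx \<bullet> ds + d\<kappa> * d\<tau> + \<eta> * (real CARD('k option) * (\<nu> * m) - real CARD('k option) * m)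
        + \<eta>\<^sup>2 * (real CARD('k option) * m)"
      unfolding linear .
    then show ?thesis unfolding zero by (simp add: \<nu>\<eta> power2_eq_square algebra_simps)
  qed
  show mu_new: "mu CARD('k) (x + dx) (s + ds) (\<kappa> + d\<kappa>) (\<tau> + d\<tau>) = \<nu> * mu CARD('k) x s \<kappa> \<tau>"
  proof -
    have "(x + dx) \<bullet> (s + ds) + (\<kappa> + d\<kappa>) * (\<tau> + d\<tau>)
      = (x \<bullet> (s + ds) + \<kappa> * (\<tau> + d\<tau>) + (dx \<bullet> s + d\<kappa> * \<tau>)) + (dx \<bullet> ds + d\<kappa> * d\<tau>)"
      by (simp add: inner_add_left inner_add_right algebra_simps)
    then have "(x + dx) \<bullet> (s + ds) + (\<kappa> + d\<kappa>) * (\<tau> + d\<tau>) = (real CARD('k) + 1) * (\<nu> * m)"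
      by (simp add: linear orth card_option_UNIV[symmetric])
    then show ?thesis unfolding mu_def[of _ "x + dx"] by (simp add: m_def)
  qed

  have N2': "in_cone_interior (?x i)" "in_cone_interior (?s i)"
    "(\<Sum>i\<in>UNIV. gap m (?x i) (?s i)) \<le> \<gamma>\<^sup>2 * m\<^sup>2 / 2" for i
    using N2 \<gamma> unfolding m_def by (simp_all add: N2_iff_gap)
  have m_pos: "0 < m"
  proof -
    have "0 < (\<Sum>i\<in>UNIV. ?x i \<bullet> ?s i)" using N2' by (intro sum_pos inner_pos) auto
    then show ?thesis unfolding trace by (simp add: zero_less_mult_iff)
  qed
  have orth': "(\<Sum>i\<in>UNIV. ?dx i \<bullet> ?ds i) = 0"
    using orth by (simp add: sum_inner_blocks_with_scalar)
  have "(1 - \<nu>)\<^sup>2 * real CARD('k option) = \<delta>\<^sup>2 / 2" using \<nu>_\<delta> by (simp only: card_option_UNIV)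
  note step = short_step[OF m_pos \<gamma> \<nu> this parameters N2'(1,2) trace N2'(3) newton[THEN conjunct1] orth']
  show "(x + dx, y + dy, s + ds, \<kappa> + d\<kappa>, \<tau> + d\<tau>) \<in> N2 blk lead \<gamma>"
    using step \<gamma> by (simp add: N2_iff_gap blocks_with_scalar_add mu_new m_def)
qed

end

section \<open>Invariance along the iterates\<close>

theorem proposition5:
  fixes blk :: "'n::finite \<Rightarrow> 'k::finite" and lead :: "'k \<Rightarrow> 'n"
    and A :: "real^'n^'p::finite" and b :: "real^'p" and c :: "real^'n"
    and \<gamma> \<delta> \<epsilon> :: real
    and x0 x s0 s :: "real^'n" and y0 y :: "real^'p" and \<kappa>0 \<kappa> \<tau>0 \<tau> :: real
    and j :: nat
  assumes "\<And>i. blk (lead i) = i"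
    and "rank A = CARD('p)" and "CARD('p) \<le> CARD('n)"
    and "0 < \<gamma>" and "\<gamma> < 1 / 3" and "0 < \<delta>" and "\<delta> < 1" and "0 < \<epsilon>" and "\<epsilon> < 1"
    and "4 * (\<gamma>\<^sup>2 + \<delta>\<^sup>2) / (1 - 3 * \<gamma>)\<^sup>2
           * inverse (1 - \<delta> / sqrt (2 * (real CARD('k) + 1))) < \<gamma>"
    and "(x0, y0, s0, \<kappa>0, \<tau>0) \<in> N2 blk lead \<gamma>"
    and "iterate_after blk lead A b c \<delta> \<epsilon> (scaling_matrices blk lead)
           (x0, y0, s0, \<kappa>0, \<tau>0) j (x, y, s, \<kappa>, \<tau>)"
  shows "(x, y, s, \<kappa>, \<tau>) \<in> N2 blk lead \<gamma> \<and>
    norm (r_p A b (x, y, s, \<kappa>, \<tau>))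
      = (1 - \<delta> / sqrt (2 * (real CARD('k) + 1))) ^ j * norm (r_p A b (x0, y0, s0, \<kappa>0, \<tau>0)) \<and>
    norm (r_d A c (x, y, s, \<kappa>, \<tau>))
      = (1 - \<delta> / sqrt (2 * (real CARD('k) + 1))) ^ j * norm (r_d A c (x0, y0, s0, \<kappa>0, \<tau>0)) \<and>
    mu CARD('k) x s \<kappa> \<tau>
      = (1 - \<delta> / sqrt (2 * (real CARD('k) + 1))) ^ j * mu CARD('k) x0 s0 \<kappa>0 \<tau>0"
proof -
  interpret cone_blocks blk lead by unfold_locales (fact assms(1))
  define \<nu> where "\<nu> = nu CARD('k) \<delta>"
  have \<nu>_eq: "1 - \<delta> / sqrt (2 * (real CARD('k) + 1)) = \<nu>" by (simp add: \<nu>_def nu_def)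
  have root: "1 < sqrt (2 * (real CARD('k) + 1))" by simp
  then have "\<delta> < sqrt (2 * (real CARD('k) + 1))" using assms(7) by linarith
  then have \<nu>: "0 < \<nu>" "\<nu> < 1"
    unfolding \<nu>_eq[symmetric] using root assms(6) by simp_all
  have \<nu>_\<delta>: "(1 - \<nu>)\<^sup>2 * (real CARD('k) + 1) = \<delta>\<^sup>2 / 2"
  proof -
    have "(\<delta> / sqrt (2 * r))\<^sup>2 * r = \<delta>\<^sup>2 / 2" if "0 < r" for r
      using that by (simp add: power_divide)
    from this[of "real CARD('k) + 1"] show ?thesis by (simp add: \<nu>_eq[symmetric])
  qed
  have parameters: "4 * (\<gamma>\<^sup>2 + \<delta>\<^sup>2) / (1 - 3 * \<gamma>)\<^sup>2 < \<gamma> * \<nu>"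
    using mult_strict_right_mono[OF assms(10)[unfolded \<nu>_eq] \<nu>(1)] \<nu>(1) by (simp add: mult.assoc)
  let ?claim = "\<lambda>j z. case z of (x, y, s, \<kappa>, \<tau>) \<Rightarrow>
    z \<in> N2 blk lead \<gamma> \<and>
    norm (r_p A b z) = \<nu> ^ j * norm (r_p A b (x0, y0, s0, \<kappa>0, \<tau>0)) \<and>
    norm (r_d A c z) = \<nu> ^ j * norm (r_d A c (x0, y0, s0, \<kappa>0, \<tau>0)) \<and>
    mu CARD('k) x s \<kappa> \<tau> = \<nu> ^ j * mu CARD('k) x0 s0 \<kappa>0 \<tau>0"
  have "?claim j z" if "iterate_after blk lead A b c \<delta> \<epsilon> (scaling_matrices blk lead)
      (x0, y0, s0, \<kappa>0, \<tau>0) j z" for j z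
    using that
  proof (induction rule: iterate_after.induct)
    case start
    show ?case using assms(11) by simp
  next
    case (step j z D dz)
    obtain x y s \<kappa> \<tau> where z: "z = (x, y, s, \<kappa>, \<tau>)" by (cases z)
    obtain dx dy ds d\<kappa> d\<tau> where dz: "dz = (dx, dy, ds, d\<kappa>, d\<tau>)" by (cases dz)
    have IH: "(x, y, s, \<kappa>, \<tau>) \<in> N2 blk lead \<gamma>" using step.IH by (simp add: z)
    have dir: "search_direction blk lead A b c \<nu> D (x, y, s, \<kappa>, \<tau>) (dx, dy, ds, d\<kappa>, d\<tau>)"
      using step.hyps(4) unfolding z dz \<nu>_def .
    note it = iteration[OF assms(4,5) \<nu> \<nu>_\<delta> parameters step.hyps(3) IH dir]
    have z_dz: "(x, y, s, \<kappa>, \<tau>) + dz = (x + dx, y + dy, s + ds, \<kappa> + d\<kappa>, \<tau> + d\<tau>)"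
      by (simp add: dz)
    show ?case
      using step.IH \<nu>(1) it(1) unfolding z z_dz prod.case it(2,3,4) by simp
  qed
  from this[OF assms(12)] show ?thesis unfolding \<nu>_eq by simp
qed

end
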